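(* Let $I\in\mathbb{S}$ and let $P(x)=\sum_\ell x^\ell a_\ell$ be a nonzero slice regular polynomial with all $a_\ell\in\mathbb{C}_I$. Then \[\lim_{n\to+\infty}\frac1n m_{\mathbb{H}}(P^{\ast n})=\frac2\pi\int_0^\pi\log\max\{|P(e^{I\theta})|,|P(e^{-I\theta})|\}\sin^2\theta\,d\theta,\] and \[\lim_{m\to+\infty}\frac{1}{-m}\, m_{\mathbb{H}}(P^{\ast(-m)})=\frac2\pi\int_0^\pi\log\min\{|P(e^{I\theta})|,|P(e^{-I\theta})|\}\sin^2\theta\,d\theta,\] where $P^{\ast(-m)}(x):=(P^s(x))^{-m}\,(P^c)^{\ast m}(x)$ (defined off the zero set of $P^s$).
   Context: $\mathbb{H}$ denotes the quaternions, $\mathbb{S}$ the sphere of unit imaginary quaternions, $\mathbb{C}_I=\mathbb{R}+\mathbb{R}I$, $e^{I\theta}=\cos\theta+I\sin\theta$. $m_{\mathbb{H}}(F)=\int_{|x|=1}\log|F(x)|\,d\mu$ with $\mu$ the probability Haar measure on unit quaternions. For slice regular polynomials $P=\sum x^\ell a_\ell$, $Q=\sum x^\ell b_\ell$ (coefficients on the right), $(P\ast Q)(x)=\sum_n x^n\sum_{l=0}^na_lb_{n-l}$; $P^{\ast n}$ is the $n$-fold $\ast$-power; $P^c=\sum x^\ell\overline{a_\ell}$; $P^s=P\ast P^c$ (a polynomial with real coefficients). *)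

theory Defs
  imports "HOL-Analysis.Analysis"
begin

text \<open>Quaternions are modelled as vectors in real^4 (components 1,2,3,4 = real part, i, j, k).
  The Euclidean norm is the quaternion modulus.\<close>

type_synonym quat = "real^4"

definition qmk :: "real \<Rightarrow> real \<Rightarrow> real \<Rightarrow> real \<Rightarrow> quat" where
  "qmk a b c d = (\<chi> i. if i = 1 then a else if i = 2 then b else if i = 3 then c else d)"

definition qmult :: "quat \<Rightarrow> quat \<Rightarrow> quat" where
  "qmult p q = qmk
     (p$1*q$1 - p$2*q$2 - p$3*q$3 - p$4*q$4)
     (p$1*q$2 + p$2*q$1 + p$3*q$4 - p$4*q$3)
     (p$1*q$3 - p$2*q$4 + p$3*q$1 + p$4*q$2)
     (p$1*q$4 + p$2*q$3 - p$3*q$2 + p$4*q$1)"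

definition qreal :: "real \<Rightarrow> quat" where
  "qreal r = qmk r 0 0 0"

definition qcnj :: "quat \<Rightarrow> quat" where
  "qcnj q = qmk (q$1) (- q$2) (- q$3) (- q$4)"

definition qinv :: "quat \<Rightarrow> quat" where
  "qinv q = (1 / (norm q)^2) *\<^sub>R qcnj q"

fun qpow :: "quat \<Rightarrow> nat \<Rightarrow> quat" where
  "qpow q 0 = qreal 1"
| "qpow q (Suc n) = qmult q (qpow q n)"

text \<open>Sphere of unit imaginary quaternions.\<close>
definition unit_imag :: "quat set" where
  "unit_imag = {q. q$1 = 0 \<and> norm q = 1}"

text \<open>The slice C_I = R + R I.\<close>
definition slice :: "quat \<Rightarrow> quat set" where
  "slice I = {qreal a + b *\<^sub>R I | a b. True}"

definition qexpI :: "quat \<Rightarrow> real \<Rightarrow> quat" where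
  "qexpI I \<theta> = qreal (cos \<theta>) + sin \<theta> *\<^sub>R I"

text \<open>Slice regular polynomials: finitely supported coefficient sequences, coefficients
  written on the right: P(x) = sum x^l a_l.\<close>

definition qeval :: "(nat \<Rightarrow> quat) \<Rightarrow> quat \<Rightarrow> quat" where
  "qeval a x = (\<Sum>l | a l \<noteq> 0. qmult (qpow x l) (a l))"

definition qstar :: "(nat \<Rightarrow> quat) \<Rightarrow> (nat \<Rightarrow> quat) \<Rightarrow> (nat \<Rightarrow> quat)" where
  "qstar a b = (\<lambda>n. \<Sum>l\<le>n. qmult (a l) (b (n - l)))"

fun qstarpow :: "(nat \<Rightarrow> quat) \<Rightarrow> nat \<Rightarrow> (nat \<Rightarrow> quat)" where
  "qstarpow a 0 = (\<lambda>n. if n = 0 then qreal 1 else 0)"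
| "qstarpow a (Suc k) = qstar a (qstarpow a k)"

definition qpcnj :: "(nat \<Rightarrow> quat) \<Rightarrow> (nat \<Rightarrow> quat)" where
  "qpcnj a = (\<lambda>l. qcnj (a l))"

definition qsym :: "(nat \<Rightarrow> quat) \<Rightarrow> (nat \<Rightarrow> quat)" where
  "qsym a = qstar a (qpcnj a)"

text \<open>P^{*(-m)}(x) = (P^s(x))^{-m} (P^c)^{*m}(x).\<close>
definition qnegstarpow_eval :: "(nat \<Rightarrow> quat) \<Rightarrow> nat \<Rightarrow> quat \<Rightarrow> quat" where
  "qnegstarpow_eval a m x =
     qmult (qinv (qpow (qeval (qsym a) x) m)) (qeval (qstarpow (qpcnj a) m) x)"

text \<open>Mahler measure w.r.t. the normalized Haar (= normalized surface) measure on the unit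
  quaternions, written via the cone measure: the normalized surface measure of A \<subseteq> S^3 equals
  the normalized Lebesgue measure of the cone {t x | x \<in> A, 0 < t \<le> 1}.\<close>
definition mH :: "(quat \<Rightarrow> quat) \<Rightarrow> real" where
  "mH F = (LINT x : ball 0 1 | lborel. ln (norm (F (x /\<^sub>R norm x))))
          / measure lborel (ball (0::quat) 1)"

end

theory Submission
  imports Defs "HOL-Computational_Algebra.Fundamental_Theorem_Algebra"
begin

text \<open>
  For a unit quaternion $x = e^{J\theta}$ and $P$ with coefficients in the slice of $I$, put
  $u = P(e^{I\theta})$, $v = P(e^{-I\theta})$ and $t = \langle J, I\rangle$. Then exactly
  $|P^{\ast n}(x)|^2 = \frac{1+t}{2}|u|^{2n} + \frac{1-t}{2}|v|^{2n}$ and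
  $|P^{\ast(-n)}(x)|^2 = \frac{1+t}{2}|u|^{-2n} + \frac{1-t}{2}|v|^{-2n}$. Hence
  $\log|P^{\ast n}(x)|$ differs from $n \log\max(|u|,|v|)$, and $\log|P^{\ast(-n)}(x)|$ from
  $-n\log\min(|u|,|v|)$, by at most $-\log(|\langle x, w\rangle|/2)$ for any unit vector $w$
  orthogonal to $1$ and $I$. This bound is integrable and independent of $n$, so it disappears after
  division by $n$; the limit is an integral of a function of $\mathrm{Re}\,x = \cos\theta$, whose
  distribution on the sphere has density $\frac{2}{\pi}\sin^2\theta\,d\theta$.
\<close>

section \<open>Slice polynomials as complex polynomials\<close>

text \<open>On the slice of \<open>I\<close> itself one of the weights (1 + t)/2 and (1 - t)/2
  vanishes, and only one of the two values is seen there. A comparison that does not depend on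
  \<open>n\<close> must therefore, in general, blow up near that slice and still be integrable. A
  unit vector \<open>w\<close> orthogonal to 1 and \<open>I\<close> supplies this through a single
  linear coordinate: with d = |<x, w>| one has t^2 + d^2 \<le> 1, so both weights are at least d^2/4
  at once, and integrability is reduced to that of a logarithm on an interval. Since
  \<open>mH\<close> integrates over the unit ball a function that is constant on rays, the linear
  coordinate can be integrated over the ball directly, without spherical coordinates. The estimates
  are made only where neither u nor v vanishes; this excludes finitely many values of Re x, a null
  set. Both limits rest on the same estimate, because the larger of 1/|u| and 1/|v| is the inverse
  of min(|u|, |v|).\<close>

lemma qmk_nth [simp]:
  "qmk a b c d $ 1 = a" "qmk a b c d $ 2 = b" "qmk a b c d $ 3 = c" "qmk a b c d $ 4 = d"
  by (simp_all add: qmk_def)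

lemma quat_eq_iff: "(p::quat) = q \<longleftrightarrow> p$1 = q$1 \<and> p$2 = q$2 \<and> p$3 = q$3 \<and> p$4 = q$4"
  by (simp add: vec_eq_iff forall_4)

lemma quat_inner: "(p::quat) \<bullet> q = p$1 * q$1 + p$2 * q$2 + p$3 * q$3 + p$4 * q$4"
  by (simp add: inner_vec_def sum_4)

lemma quat_norm_sq: "(norm (q::quat))\<^sup>2 = (q$1)\<^sup>2 + (q$2)\<^sup>2 + (q$3)\<^sup>2 + (q$4)\<^sup>2"
  by (simp only: power2_norm_eq_inner) (simp add: quat_inner power2_eq_square)

lemma unit_imag_iff: "I \<in> unit_imag \<longleftrightarrow> I$1 = 0 \<and> (I$2)\<^sup>2 + (I$3)\<^sup>2 + (I$4)\<^sup>2 = 1"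
proof -
  have "norm I = 1 \<longleftrightarrow> (norm I)\<^sup>2 = 1"
    by (metis norm_ge_zero one_power2 power2_eq_iff_nonneg zero_le_one)
  then show ?thesis by (auto simp: unit_imag_def quat_norm_sq)
qed

text \<open>Euler's four-square identity, checked as a polynomial identity after squaring both
  norms.\<close>

lemma norm_qmult: "norm (qmult p q) = norm p * norm q"
proof -
  have "(norm (qmult p q))\<^sup>2 = (norm p * norm q)\<^sup>2"
    unfolding power_mult_distrib quat_norm_sq qmult_def qmk_nth by algebra
  then show ?thesis by (simp add: power2_eq_iff_nonneg)
qed

lemma norm_qpow: "norm (qpow q n) = norm q ^ n"
proof (induction n)
  case 0
  show ?case by (simp add: qreal_def norm_eq_sqrt_inner quat_inner)
qed (simp add: norm_qmult)

lemma norm_qinv: "norm (qinv q) = inverse (norm q)"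
proof -
  have "(norm (qcnj q))\<^sup>2 = (norm q)\<^sup>2"
    by (simp add: quat_norm_sq qcnj_def)
  then have "norm (qcnj q) = norm q" by (simp add: power2_eq_iff_nonneg)
  then show ?thesis by (simp add: qinv_def power2_eq_square divide_simps)
qed

text \<open>For \<open>I\<close> in \<open>unit_imag\<close> this is the isometric ring isomorphism
  from the complex numbers onto the slice of \<open>I\<close> that sends the imaginary unit to
  \<open>I\<close>.\<close>

definition slice_emb :: "quat \<Rightarrow> complex \<Rightarrow> quat" where
  "slice_emb I z = qreal (Re z) + Im z *\<^sub>R I"

lemma slice_emb_0 [simp]: "slice_emb I 0 = 0"
  by (simp add: slice_emb_def qreal_def quat_eq_iff)

lemma slice_emb_1: "slice_emb I 1 = qreal 1"
  by (simp add: slice_emb_def)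

lemma slice_emb_add: "slice_emb I (z + w) = slice_emb I z + slice_emb I w"
  by (simp add: slice_emb_def qreal_def quat_eq_iff algebra_simps)

lemma slice_emb_sum: "slice_emb I (\<Sum>x\<in>A. f x) = (\<Sum>x\<in>A. slice_emb I (f x))"
  by (induction A rule: infinite_finite_induct) (simp_all add: slice_emb_add)

lemma slice_emb_cis: "slice_emb I (cis \<theta>) = qexpI I \<theta>"
  by (simp add: slice_emb_def qexpI_def)

context
  fixes I :: quat
  assumes I: "I \<in> unit_imag"
begin

lemma slice_emb_mult: "slice_emb I (z * w) = qmult (slice_emb I z) (slice_emb I w)"
proof -
  have I1: "I$1 = 0" and e: "(I$2)\<^sup>2 + (I$3)\<^sup>2 + (I$4)\<^sup>2 = 1" using I by (auto simp: unit_imag_iff)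
  have "Im z * Im w * ((I$2)\<^sup>2 + (I$3)\<^sup>2 + (I$4)\<^sup>2) = Im z * Im w"
    by (simp add: e)
  then have "Im z * I$2 * (Im w * I$2) + Im z * I$3 * (Im w * I$3) + Im z * I$4 * (Im w * I$4)
    = Im z * Im w"
    by (simp only: algebra_simps power2_eq_square)
  then show ?thesis
    by (simp add: slice_emb_def qreal_def quat_eq_iff qmult_def I1 ring_distribs)
qed

end

text \<open>Placed between the two contexts so that it is available for every \<open>J\<close>:
  evaluation needs it at the imaginary unit of the evaluation point, while the coefficients lie in
  the slice of the fixed \<open>I\<close>.\<close>

lemma slice_emb_power: "J \<in> unit_imag \<Longrightarrow> slice_emb J (z ^ n) = qpow (slice_emb J z) n"
  by (induction n) (simp_all add: slice_emb_mult slice_emb_1)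

context
  fixes I :: quat
  assumes I: "I \<in> unit_imag"
begin

lemma norm_slice_emb: "norm (slice_emb I z) = cmod z"
proof -
  have I1: "I$1 = 0" and e: "(I$2)\<^sup>2 = 1 - (I$3)\<^sup>2 - (I$4)\<^sup>2" using I by (auto simp: unit_imag_iff)
  have "(norm (slice_emb I z))\<^sup>2 = (cmod z)\<^sup>2"
    by (simp add: quat_norm_sq slice_emb_def qreal_def I1 power_mult_distrib e algebra_simps
        cmod_power2)
  then show ?thesis by (simp add: power2_eq_iff_nonneg)
qed

lemma slice_emb_eq_0_iff [simp]: "slice_emb I z = 0 \<longleftrightarrow> z = 0"
  using norm_slice_emb[of z] by (metis norm_eq_zero)

lemma slice_emb_cnj: "slice_emb I (cnj z) = qcnj (slice_emb I z)"
  using I by (simp add: slice_emb_def qcnj_def quat_eq_iff qreal_def unit_imag_iff)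

lemma slice_eq_range: "slice I = range (slice_emb I)"
proof -
  have "qreal a + b *\<^sub>R I = slice_emb I (Complex a b)" for a b
    by (simp add: slice_emb_def)
  moreover have "\<exists>a b. slice_emb I z = qreal a + b *\<^sub>R I" for z
    by (auto simp: slice_emb_def)
  ultimately show ?thesis
    unfolding slice_def by blast
qed

lemma slice_poly_obtain:
  assumes "finite {l. a l \<noteq> 0}" "\<forall>l. a l \<in> slice I"
  obtains p :: "complex poly" where "a = (\<lambda>l. slice_emb I (coeff p l))"
proof -
  from assms(2) have "\<forall>l. \<exists>z. a l = slice_emb I z" by (auto simp: slice_eq_range)
  then obtain c where c: "\<And>l. a l = slice_emb I (c l)" by metis
  have "coeff (Abs_poly c) = c"
    using assms(1) by (intro Abs_poly_inverse) (simp add: c MOST_iff_cofinite)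
  then show thesis using that[of "Abs_poly c"] c by auto
qed

text \<open>The star product is the Cauchy product of coefficient sequences and
  \<open>slice_emb I\<close> is multiplicative. Star products with coefficients in one slice are
  thus products of complex polynomials, and star powers are ordinary powers.\<close>

lemma qstar_slice:
  "qstar (\<lambda>l. slice_emb I (coeff p l)) (\<lambda>l. slice_emb I (coeff q l))
     = (\<lambda>l. slice_emb I (coeff (p * q) l))"
  by (simp add: qstar_def coeff_mult slice_emb_sum slice_emb_mult[OF I] fun_eq_iff)

lemma qstarpow_slice:
  "qstarpow (\<lambda>l. slice_emb I (coeff p l)) n = (\<lambda>l. slice_emb I (coeff (p ^ n) l))"
proof (induction n)
  case 0
  show ?case by (auto simp: slice_emb_1 fun_eq_iff)
next
  case (Suc n)
  then show ?case by (simp add: qstar_slice)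
qed

lemma qpcnj_slice:
  "qpcnj (\<lambda>l. slice_emb I (coeff p l)) = (\<lambda>l. slice_emb I (coeff (map_poly cnj p) l))"
  by (simp add: qpcnj_def coeff_map_poly slice_emb_cnj)

lemma poly_map_poly_cnj: "poly (map_poly cnj p) z = cnj (poly p (cnj z))"
  using poly_cnj[of p "cnj z"] by simp

text \<open>Since powers of $x = \alpha + J\beta$ are real combinations of $1$ and $J$, one has $P(x) = A + JB$ with
  $A = (P(z) + P(\bar z))/2$ and $B = (P(z) - P(\bar z))/(2I)$ in the slice of $I$, and the only
  cross term of the norm involves $\langle J, I\rangle$.\<close>

lemma qeval_slice_norm_sq:
  assumes J: "J \<in> unit_imag"
  shows "(norm (qeval (\<lambda>l. slice_emb I (coeff p l)) (slice_emb J z)))\<^sup>2 =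
    (1 + J \<bullet> I) / 2 * (cmod (poly p z))\<^sup>2 + (1 - J \<bullet> I) / 2 * (cmod (poly p (cnj z)))\<^sup>2"
proof -
  define A where "A = (\<Sum>l\<le>degree p. of_real (Re (z ^ l)) * coeff p l)"
  define B where "B = (\<Sum>l\<le>degree p. of_real (Im (z ^ l)) * coeff p l)"
  have qJ: "qpow (slice_emb J z) l = slice_emb J (z ^ l)" for l
    by (simp only: slice_emb_power[OF J])
  have lin: "qmult (slice_emb J w) (slice_emb I c) =
      slice_emb I (of_real (Re w) * c) + qmult J (slice_emb I (of_real (Im w) * c))" for w c
    by (simp add: slice_emb_def qreal_def quat_eq_iff qmult_def algebra_simps)
  have qsum: "qmult J (\<Sum>x\<in>A. f x) = (\<Sum>x\<in>A. qmult J (f x))" for A and f :: "nat \<Rightarrow> quat"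
  proof (induction A rule: infinite_finite_induct)
    case (insert x F)
    then show ?case
      by (simp add: qmult_def quat_eq_iff algebra_simps)
  qed (simp_all add: qmult_def quat_eq_iff)
  have "qeval (\<lambda>l. slice_emb I (coeff p l)) (slice_emb J z)
      = (\<Sum>l\<le>degree p. qmult (slice_emb J (z ^ l)) (slice_emb I (coeff p l)))"
    unfolding qeval_def qJ
    by (rule sum.mono_neutral_cong_left)
       (auto intro: le_degree simp: qmult_def quat_eq_iff)
  also have "\<dots> = slice_emb I A + qmult J (slice_emb I B)"
    by (simp add: lin sum.distrib A_def B_def slice_emb_sum qsum)
  finally have ev: "qeval (\<lambda>l. slice_emb I (coeff p l)) (slice_emb J z)
      = slice_emb I A + qmult J (slice_emb I B)" .
  have I1: "I$1 = 0" using I by (simp add: unit_imag_iff)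
  have J1: "J$1 = 0" and nJ: "norm J = 1" using J by (auto simp: unit_imag_def)
  \<comment> \<open>For a, b in the slice of \<open>I\<close>, <a, J b> is the inner product of
    \<open>J\<close> with a conj(b). As \<open>J\<close> has no real part, only the component along
    \<open>I\<close> contributes, with coefficient Im (A conj(B)).\<close>
  have "slice_emb I A \<bullet> qmult J (slice_emb I B) = (J \<bullet> I) * (Im A * Re B - Re A * Im B)"
    by (simp add: slice_emb_def qreal_def qmult_def quat_inner I1 J1 algebra_simps)
  then have "(norm (slice_emb I A + qmult J (slice_emb I B)))\<^sup>2 =
     (cmod A)\<^sup>2 + (cmod B)\<^sup>2 + 2 * (J \<bullet> I) * (Im A * Re B - Re A * Im B)"
    by (simp add: power2_norm_eq_inner inner_add inner_commute)
       (simp add: norm_qmult nJ norm_slice_emb flip: power2_norm_eq_inner)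
  moreover have u: "poly p z = A + \<i> * B"
    unfolding poly_altdef A_def B_def sum_distrib_left sum.distrib[symmetric]
    by (rule sum.cong) (auto simp: complex_eq_iff algebra_simps)
  moreover have v: "poly p (cnj z) = A - \<i> * B"
    unfolding poly_altdef A_def B_def sum_distrib_left sum_subtractf[symmetric]
    by (rule sum.cong) (auto simp: complex_eq_iff algebra_simps simp flip: complex_cnj_power)
  \<comment> \<open>Here |u|^2 + |v|^2 = 2 (|A|^2 + |B|^2) and |u|^2 - |v|^2 = 4 Im (A conj(B)) for
    the two values u, v of the polynomial, so the norm becomes the weighted mean.\<close>
  ultimately show ?thesis
    unfolding ev u v cmod_power2 by (simp add: field_simps power2_eq_square)
qed
text \<open>The case J = I, where the weight of the conjugate value is 0. It identifies the
  integrands of the theorem with complex moduli.\<close>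

lemma norm_qeval_slice:
  "norm (qeval (\<lambda>l. slice_emb I (coeff p l)) (slice_emb I z)) = cmod (poly p z)"
proof -
  have "I \<bullet> I = 1" using I by (auto simp: unit_imag_def norm_eq_1)
  then have "(norm (qeval (\<lambda>l. slice_emb I (coeff p l)) (slice_emb I z)))\<^sup>2 = (cmod (poly p z))\<^sup>2"
    using qeval_slice_norm_sq[OF I, of p z] by simp
  then show ?thesis by (simp add: power2_eq_iff_nonneg)
qed

end

section \<open>Integrals over the unit ball\<close>

lemma ball_in_borel [measurable, simp]: "ball c r \<in> sets borel"
  by (rule borel_open) simp

section \<open>Integrals over the ball of functions of one linear coordinate or of one direction
  cosine\<close>

lemma nn_integral_lborel_translate:
  fixes f :: "'a::euclidean_space \<Rightarrow> ennreal"
  assumes [measurable]: "f \<in> borel_measurable borel"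
  shows "(\<integral>\<^sup>+x. f (t + x) \<partial>lborel) = (\<integral>\<^sup>+x. f x \<partial>lborel)"
proof -
  have "(\<integral>\<^sup>+x. f x \<partial>lborel) = (\<integral>\<^sup>+x. f x \<partial>distr lborel borel ((+) t))"
    by (simp add: lborel_distr_plus)
  also have "\<dots> = (\<integral>\<^sup>+x. f (t + x) \<partial>lborel)"
    by (subst nn_integral_distr) auto
  finally show ?thesis ..
qed

lemma nn_integral_lborel_scale:
  fixes f :: "'a::euclidean_space \<Rightarrow> ennreal"
  assumes [measurable]: "f \<in> borel_measurable borel" and "k > 0"
  shows "(\<integral>\<^sup>+x. f x \<partial>lborel) = ennreal (k ^ DIM('a)) * (\<integral>\<^sup>+x. f (k *\<^sub>R x) \<partial>lborel)"
  using assms(2)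
  by (subst lborel_affine[of k 0])
     (simp_all add: nn_integral_density nn_integral_distr nn_integral_cmult)

text \<open>The left-hand side is unchanged by translating $x$ along $w$; averaging over translations by
  $s \in [0,1]$ turns it into a one-dimensional integral of $f$ for each fixed $x$.\<close>

lemma nn_integral_ball_inner_le:
  fixes w :: "'a::euclidean_space" and f :: "real \<Rightarrow> ennreal"
  assumes [measurable]: "f \<in> borel_measurable borel" and w: "norm w = 1"
  shows "(\<integral>\<^sup>+x\<in>ball 0 1. f (x \<bullet> w) \<partial>lborel)
    \<le> emeasure lborel (ball (0::'a) 2) * (\<integral>\<^sup>+s\<in>{-1..1}. f s \<partial>lborel)"
proof -
  define B :: "'a set" where "B = ball 0 1"
  have [measurable]: "B \<in> sets borel" by (simp add: B_def)
  have ww: "w \<bullet> w = 1" using w by (simp add: norm_eq_1)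
  have sh: "(\<integral>\<^sup>+x\<in>B. f (x \<bullet> w) \<partial>lborel) =
      (\<integral>\<^sup>+x. f (x \<bullet> w + s) * indicator (B) (s *\<^sub>R w + x) \<partial>lborel)" for s
    by (subst nn_integral_lborel_translate[symmetric, where t="s *\<^sub>R w"], measurable)
       (simp_all add: inner_add_left ww add.commute)
  have "(\<integral>\<^sup>+x\<in>B. f (x \<bullet> w) \<partial>lborel) =
      (\<integral>\<^sup>+s\<in>{0..1::real}. (\<integral>\<^sup>+x\<in>B. f (x \<bullet> w) \<partial>lborel) \<partial>lborel)"
    by (simp add: nn_integral_cmult_indicator)
  also have "\<dots> = (\<integral>\<^sup>+s. \<integral>\<^sup>+x. f (x \<bullet> w + s) * indicator (B) (s *\<^sub>R w + x)
      * indicator {0..1::real} s \<partial>lborel \<partial>lborel)"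
  proof (rule nn_integral_cong)
    fix s :: real
    show "(\<integral>\<^sup>+x\<in>B. f (x \<bullet> w) \<partial>lborel) * indicator {0..1} s =
      (\<integral>\<^sup>+x. f (x \<bullet> w + s) * indicator (B) (s *\<^sub>R w + x) * indicator {0..1} s \<partial>lborel)"
      unfolding sh[of s] by (rule nn_integral_multc[symmetric]) measurable
  qed
  also have "\<dots> = (\<integral>\<^sup>+x. \<integral>\<^sup>+s. f (x \<bullet> w + s) * indicator (B) (s *\<^sub>R w + x)
      * indicator {0..1::real} s \<partial>lborel \<partial>lborel)"
    by (rule lborel_pair.Fubini') measurable
  also have "\<dots> \<le> (\<integral>\<^sup>+(x::'a). \<integral>\<^sup>+s. indicator (ball 0 2) x * (f (x \<bullet> w + s) * indicator {-1..1} (x \<bullet> w + s)) \<partial>lborel \<partial>lborel)"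
  proof (intro nn_integral_mono)
    fix x :: 'a and s :: real
    \<comment> \<open>The shift has length at most 1, hence the radius 2; the coordinate along
      \<open>w\<close> of a point of the unit ball lies in [-1, 1].\<close>
    have "x \<in> ball 0 2 \<and> x \<bullet> w + s \<in> {-1..1}" if "s *\<^sub>R w + x \<in> B" "s \<in> {0..1}"
    proof -
      have n: "norm (s *\<^sub>R w + x) < 1" using that by (simp add: B_def)
      have "norm x \<le> norm (s *\<^sub>R w + x) + norm (s *\<^sub>R w)"
        by (metis add_diff_cancel_left' norm_triangle_ineq4)
      moreover have "norm (s *\<^sub>R w) \<le> 1" using that w by simp
      moreover have "\<bar>(s *\<^sub>R w + x) \<bullet> w\<bar> \<le> norm (s *\<^sub>R w + x)"
        using Cauchy_Schwarz_ineq2[of "s *\<^sub>R w + x" w] w by simp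
      ultimately show ?thesis using n by (auto simp: inner_add_left ww abs_le_iff)
    qed
    then show "f (x \<bullet> w + s) * indicator (B) (s *\<^sub>R w + x) * indicator {0..1} s
      \<le> indicator (ball 0 2) x * (f (x \<bullet> w + s) * indicator {-1..1} (x \<bullet> w + s))"
      by (auto split: split_indicator)
  qed
  also have "\<dots> = (\<integral>\<^sup>+(x::'a). indicator (ball 0 2) x * (\<integral>\<^sup>+s\<in>{-1..1}. f s \<partial>lborel) \<partial>lborel)"
  proof (rule nn_integral_cong)
    fix x :: 'a
    show "(\<integral>\<^sup>+s. indicator (ball 0 2) x * (f (x \<bullet> w + s) * indicator {-1..1} (x \<bullet> w + s)) \<partial>lborel)
        = indicator (ball 0 2) x * (\<integral>\<^sup>+s\<in>{-1..1}. f s \<partial>lborel)"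
      by (subst nn_integral_cmult, measurable)
         (subst nn_integral_lborel_translate[where f="\<lambda>s. f s * indicator {-1..1} s"], simp_all)
  qed
  also have "\<dots> = emeasure lborel (ball (0::'a) 2) * (\<integral>\<^sup>+s\<in>{-1..1}. f s \<partial>lborel)"
    by (subst nn_integral_multc) measurable
  finally show ?thesis unfolding B_def .
qed

text \<open>Substitute $x = (|y| s, y)$: the slope $s$ determines the argument of $f$, and the
  integral over $y$ scales with the power $4$ of $1/\sqrt{1+s^2}$.\<close>

lemma nn_integral_ball_cone:
  fixes f :: "real \<Rightarrow> ennreal"
  assumes [measurable]: "f \<in> borel_measurable borel" and dim: "DIM('b::euclidean_space) = 3"
  shows "(\<integral>\<^sup>+x\<in>ball (0::real \<times> 'b) 1. f (fst x / norm x) \<partial>lborel)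
    = (\<integral>\<^sup>+y\<in>ball (0::'b) 1. ennreal (norm y) \<partial>lborel) *
      (\<integral>\<^sup>+s. f (s / sqrt (1 + s\<^sup>2)) * ennreal (1 / (1 + s\<^sup>2)\<^sup>2) \<partial>lborel)"
proof -
  define C where "C = (\<integral>\<^sup>+y\<in>ball (0::'b) 1. ennreal (norm y) \<partial>lborel)"
  define B where "B = (ball 0 1 :: (real \<times> 'b) set)"
  have [measurable]: "B \<in> sets borel" by (simp add: B_def)
  have [measurable]: "(\<lambda>x::real \<times> 'b. fst x / norm x) \<in> borel_measurable borel"
    by (intro borel_measurable_divide borel_measurable_continuous_onI continuous_intros)
  have m: "(\<lambda>x. f (fst x / norm x) * indicator B x) \<in> borel_measurable borel"
    by measurable
  have pos: "1 + s\<^sup>2 > 0" for s :: real by (smt (verit) zero_le_power2)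
  have in_B: "(a, y) \<in> B \<longleftrightarrow> a\<^sup>2 + (norm y)\<^sup>2 < 1" for a and y :: 'b
    by (simp add: B_def norm_Pair)
  have nrm: "norm (norm y * s, y) = norm y * sqrt (1 + s\<^sup>2)" for s and y :: 'b
  proof -
    have "(norm y * s)\<^sup>2 + (norm y)\<^sup>2 = (norm y)\<^sup>2 * (1 + s\<^sup>2)"
      by (simp add: algebra_simps power2_eq_square)
    then show ?thesis by (simp add: norm_Pair real_sqrt_mult)
  qed
  have "(\<integral>\<^sup>+x\<in>B. f (fst x / norm x) \<partial>lborel)
     = (\<integral>\<^sup>+x. f (fst x / norm x) * indicator B x \<partial>(lborel \<Otimes>\<^sub>M lborel))"
    by (simp add: lborel_prod)
  also have "\<dots> = (\<integral>\<^sup>+y. \<integral>\<^sup>+a. f (a / norm (a, y)) * indicator B (a, y) \<partial>lborel \<partial>lborel)"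
    by (subst lborel_pair.nn_integral_snd[symmetric]) (simp_all add: lborel_prod m)
  \<comment> \<open>The substitution a = |y| s needs |y| > 0; the single point y = 0 is
    null.\<close>
  also have "\<dots> = (\<integral>\<^sup>+(y::'b). \<integral>\<^sup>+s. ennreal (norm y) * (f (s / sqrt (1 + s\<^sup>2)) * indicator (ball 0 1) (sqrt (1 + s\<^sup>2) *\<^sub>R y)) \<partial>lborel \<partial>lborel)"
  proof (rule nn_integral_cong_AE)
    have "(\<integral>\<^sup>+a. f (a / norm (a, y)) * indicator B (a, y) \<partial>lborel) =
      (\<integral>\<^sup>+s. ennreal (norm y) * (f (s / sqrt (1 + s\<^sup>2)) * indicator (ball 0 1) (sqrt (1 + s\<^sup>2) *\<^sub>R y)) \<partial>lborel)"
      if "y \<noteq> 0" for y :: 'b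
    proof -
      have "(\<integral>\<^sup>+a. f (a / norm (a, y)) * indicator B (a, y) \<partial>lborel) =
        ennreal (norm y) * (\<integral>\<^sup>+s. f (norm y * s / norm (norm y * s, y)) * indicator B (norm y * s, y) \<partial>lborel)"
        using that by (subst nn_integral_real_affine[where c="norm y" and t=0]) simp_all
      also have "(\<lambda>s. f (norm y * s / norm (norm y * s, y)) * indicator B (norm y * s, y)) =
        (\<lambda>s. f (s / sqrt (1 + s\<^sup>2)) * indicator (ball 0 1) (sqrt (1 + s\<^sup>2) *\<^sub>R y))"
      proof
        fix s
        have "(norm y * s, y) \<in> B \<longleftrightarrow> sqrt (1 + s\<^sup>2) *\<^sub>R y \<in> ball 0 1"
          using nrm[of y s] by (simp add: B_def mult.commute)
        then show "f (norm y * s / norm (norm y * s, y)) * indicator B (norm y * s, y) =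
          f (s / sqrt (1 + s\<^sup>2)) * indicator (ball 0 1) (sqrt (1 + s\<^sup>2) *\<^sub>R y)"
          using that unfolding nrm by (simp add: indicator_def)
      qed
      finally show ?thesis
        by (subst nn_integral_cmult) measurable
    qed
    moreover have "AE y in lborel. y \<noteq> (0::'b)" by (rule AE_lborel_singleton)
    ultimately show "AE y::'b in lborel. (\<integral>\<^sup>+a. f (a / norm (a, y)) * indicator B (a, y) \<partial>lborel) =
      (\<integral>\<^sup>+s. ennreal (norm y) * (f (s / sqrt (1 + s\<^sup>2)) * indicator (ball 0 1) (sqrt (1 + s\<^sup>2) *\<^sub>R y)) \<partial>lborel)"
      by auto
  qed
  also have "\<dots> = (\<integral>\<^sup>+s. \<integral>\<^sup>+y. ennreal (norm (y::'b)) * (f (s / sqrt (1 + s\<^sup>2)) * indicator (ball 0 1) (sqrt (1 + s\<^sup>2) *\<^sub>R y)) \<partial>lborel \<partial>lborel)"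
    by (rule lborel_pair.Fubini'[symmetric]) measurable
  also have "\<dots> = (\<integral>\<^sup>+s. C * (f (s / sqrt (1 + s\<^sup>2)) * ennreal (1 / (1 + s\<^sup>2)\<^sup>2)) \<partial>lborel)"
  proof (rule nn_integral_cong)
    fix s :: real
    define k where "k = 1 / sqrt (1 + s\<^sup>2)"
    have k: "k > 0" "sqrt (1 + s\<^sup>2) * k = 1" "k ^ 4 = 1 / (1 + s\<^sup>2)\<^sup>2"
    proof -
      show "k > 0" "sqrt (1 + s\<^sup>2) * k = 1"
        using pos[of s] by (auto simp: k_def)
      have "sqrt (1 + s\<^sup>2) ^ 4 = (sqrt (1 + s\<^sup>2) ^ 2)\<^sup>2" by (simp only: power_mult[symmetric]) simp
      also have "\<dots> = (1 + s\<^sup>2)\<^sup>2" using pos[of s] by simp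
      finally show "k ^ 4 = 1 / (1 + s\<^sup>2)\<^sup>2" by (simp add: k_def power_divide)
    qed
    have "(\<integral>\<^sup>+y. ennreal (norm (y::'b)) * (f (s / sqrt (1 + s\<^sup>2)) * indicator (ball 0 1) (sqrt (1 + s\<^sup>2) *\<^sub>R y)) \<partial>lborel)
      = f (s / sqrt (1 + s\<^sup>2)) * (\<integral>\<^sup>+y. ennreal (norm (y::'b)) * indicator (ball 0 1) (sqrt (1 + s\<^sup>2) *\<^sub>R y) \<partial>lborel)"
      by (subst nn_integral_cmult[symmetric]) (simp_all add: mult_ac)
    \<comment> \<open>Scaling by \<open>k\<close> contributes \<open>k ^ 3\<close> from the
      dimension and one more \<open>k\<close> from the weight \<open>norm y\<close>, the Jacobian of
      the substitution in the first coordinate.\<close>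
    also have "(\<integral>\<^sup>+y. ennreal (norm (y::'b)) * indicator (ball 0 1) (sqrt (1 + s\<^sup>2) *\<^sub>R y) \<partial>lborel)
      = ennreal (k ^ 3) * (\<integral>\<^sup>+y. ennreal k * (ennreal (norm (y::'b)) * indicator (ball 0 1) y) \<partial>lborel)"
      using k by (subst nn_integral_lborel_scale[where k=k]) (simp_all add: dim ennreal_mult mult_ac)
    also have "\<dots> = ennreal (k ^ 3) * ennreal k * C"
      by (subst nn_integral_cmult) (simp_all add: C_def mult.assoc)
    also have "ennreal (k ^ 3) * ennreal k = ennreal (k ^ 4)"
      using k(1) by (simp add: eval_nat_numeral mult_ac flip: ennreal_mult)
    finally show "(\<integral>\<^sup>+y. ennreal (norm (y::'b)) * (f (s / sqrt (1 + s\<^sup>2)) * indicator (ball 0 1) (sqrt (1 + s\<^sup>2) *\<^sub>R y)) \<partial>lborel)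
      = C * (f (s / sqrt (1 + s\<^sup>2)) * ennreal (1 / (1 + s\<^sup>2)\<^sup>2))"
      by (simp add: k mult_ac)
  qed
  also have "\<dots> = C * (\<integral>\<^sup>+s. f (s / sqrt (1 + s\<^sup>2)) * ennreal (1 / (1 + s\<^sup>2)\<^sup>2) \<partial>lborel)"
    by (rule nn_integral_cmult) measurable
  finally show ?thesis by (simp add: C_def B_def)
qed

lemma emeasure_lborel_Times:
  fixes A :: "'a::euclidean_space set" and B :: "'b::euclidean_space set"
  assumes "A \<in> sets borel" "B \<in> sets borel"
  shows "emeasure lborel (A \<times> B) = emeasure lborel A * emeasure lborel B"
  unfolding lborel_prod[symmetric]
  using assms by (intro lborel.emeasure_pair_measure_Times) simp_all

section \<open>Transfer to the quaternions and the law of the real part\<close>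

lemma qmk_measurable: "(\<lambda>(a, b, c, d). qmk a b c d) \<in> borel_measurable borel"
proof (rule borel_measurable_continuous_onI)
  show "continuous_on UNIV (\<lambda>(a, b, c, d). qmk a b c d)"
    unfolding qmk_def case_prod_beta
  proof (rule continuous_on_vec_lambda)
    fix i :: 4
    show "continuous_on UNIV (\<lambda>x. if i = 1 then fst x else if i = 2 then fst (snd x)
        else if i = 3 then fst (snd (snd x)) else snd (snd (snd x)))"
      by (cases "i = 1"; cases "i = 2"; cases "i = 3") (simp_all add: continuous_intros)
  qed
qed

text \<open>Fubini was applied on a product with the first coordinate split off, whereas
  \<open>quat\<close> is a vector type. Lebesgue measure is determined by its values on boxes, and
  the coordinate map pulls boxes back to boxes.\<close>

lemma lborel_quat_distr:
  "distr (lborel :: (real \<times> real \<times> real \<times> real) measure) borel (\<lambda>(a, b, c, d). qmk a b c d) = lborel"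
proof (rule lborel_eqI[symmetric])
  note m = qmk_measurable
  fix l u :: quat
  assume lu: "\<And>b. b \<in> Basis \<Longrightarrow> l \<bullet> b \<le> u \<bullet> b"
  have lu': "l $ i \<le> u $ i" for i
    using lu[of "axis i 1"] by (simp add: inner_axis axis_in_Basis_iff)
  have "(\<lambda>(a, b, c, d). qmk a b c d) -` box l u = box (l$1, l$2, l$3, l$4) (u$1, u$2, u$3, u$4)"
    by (auto simp: mem_box_cart forall_4 box_prod qmk_def)
  then have "emeasure (distr lborel borel (\<lambda>(a, b, c, d). qmk a b c d)) (box l u)
     = emeasure lborel (box (l$1, l$2, l$3, l$4) (u$1, u$2, u$3, u$4))"
    using m by (subst emeasure_distr) (simp_all only: measurable_lborel2 space_lborel space_borel Int_UNIV_right box_borel)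
  also have "\<dots> = ennreal (\<Prod>i\<in>UNIV. u $ i - l $ i)"
    unfolding box_prod fst_conv snd_conv UNIV_4
    by (simp add: emeasure_lborel_Times borel_Times lu' ennreal_mult)
  also have "(\<Prod>i\<in>UNIV. u $ i - l $ i) = (\<Prod>b\<in>Basis. (u - l) \<bullet> b)"
  proof -
    have B: "(Basis :: quat set) = (\<lambda>i. axis i 1) ` UNIV" by (auto simp: Basis_vec_def)
    show ?thesis
      unfolding B by (subst prod.reindex) (auto simp: inj_on_def axis_eq_axis inner_axis)
  qed
  finally show "emeasure (distr lborel borel (\<lambda>(a, b, c, d). qmk a b c d)) (box l u) = ennreal (\<Prod>b\<in>Basis. (u - l) \<bullet> b)" .
qed simp

lemma nn_integral_quat_ball_cone:
  fixes f :: "real \<Rightarrow> ennreal"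
  assumes [measurable]: "f \<in> borel_measurable borel"
  shows "(\<integral>\<^sup>+x\<in>ball (0::quat) 1. f (x $ 1 / norm x) \<partial>lborel)
    = (\<integral>\<^sup>+y\<in>ball (0::real \<times> real \<times> real) 1. ennreal (norm y) \<partial>lborel) *
      (\<integral>\<^sup>+s. f (s / sqrt (1 + s\<^sup>2)) * ennreal (1 / (1 + s\<^sup>2)\<^sup>2) \<partial>lborel)"
proof -
  define T where "T = (\<lambda>(a, b, c, d). qmk a b c d)"
  have T: "distr lborel borel T = lborel" unfolding T_def by (rule lborel_quat_distr)
  have Tm [measurable]: "T \<in> borel_measurable borel" unfolding T_def by (rule qmk_measurable)
  have nT: "norm (T x) = norm x" for x
  proof -
    obtain a b c d where x: "x = (a, b, c, d)" by (cases x)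
    have "(norm (T x))\<^sup>2 = (norm x)\<^sup>2"
      by (simp only: power2_norm_eq_inner) (simp add: x T_def qmk_def inner_vec_def sum_4 inner_prod_def)
    then show ?thesis by (simp add: power2_eq_iff_nonneg)
  qed
  have T1: "T x $ 1 = fst x" for x by (simp add: T_def qmk_def case_prod_beta)
  have [measurable]: "(\<lambda>x::quat. x $ 1 / norm x) \<in> borel_measurable borel"
    by (intro borel_measurable_divide borel_measurable_continuous_onI continuous_intros)
  have "(\<integral>\<^sup>+x\<in>ball (0::quat) 1. f (x $ 1 / norm x) \<partial>lborel)
      = (\<integral>\<^sup>+x\<in>ball (0::quat) 1. f (x $ 1 / norm x) \<partial>distr lborel borel T)"
    unfolding T ..
  also have "\<dots> = (\<integral>\<^sup>+x\<in>ball (0::real \<times> real \<times> real \<times> real) 1. f (fst x / norm x) \<partial>lborel)"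
    by (subst nn_integral_distr) (simp_all add: T1 nT indicator_def)
  also have "\<dots> = (\<integral>\<^sup>+y\<in>ball (0::real \<times> real \<times> real) 1. ennreal (norm y) \<partial>lborel) *
      (\<integral>\<^sup>+s. f (s / sqrt (1 + s\<^sup>2)) * ennreal (1 / (1 + s\<^sup>2)\<^sup>2) \<partial>lborel)"
    by (rule nn_integral_ball_cone) simp_all
  finally show ?thesis .
qed

text \<open>Substitute s = cot \<theta>: then s / sqrt (1 + s^2) = cos \<theta> and 1 / (1 + s^2)^2
  = sin^4 \<theta>, and the Jacobian 1 / sin^2 \<theta> leaves sin^2 \<theta>. On the open interval
  cot is a bijection onto the line; the endpoints do not affect the integral.\<close>

lemma cot_has_absolute_integral:
  fixes h :: "real \<Rightarrow> real"
  assumes "(\<lambda>\<theta>. h (cos \<theta>) * (sin \<theta>)\<^sup>2) absolutely_integrable_on {0..pi}"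
  shows "(\<lambda>s. h (s / sqrt (1 + s\<^sup>2)) * (1 / (1 + s\<^sup>2)\<^sup>2)) absolutely_integrable_on UNIV"
    and "integral UNIV (\<lambda>s. h (s / sqrt (1 + s\<^sup>2)) * (1 / (1 + s\<^sup>2)\<^sup>2)) =
      integral {0..pi} (\<lambda>\<theta>. h (cos \<theta>) * (sin \<theta>)\<^sup>2)"
proof -
  define F where "F = (\<lambda>s. h (s / sqrt (1 + s\<^sup>2)) * (1 / (1 + s\<^sup>2)\<^sup>2))"
  have F: "\<bar>- inverse ((sin \<theta>)\<^sup>2)\<bar> * F (cot \<theta>) = h (cos \<theta>) * (sin \<theta>)\<^sup>2" if "\<theta> \<in> {0<..<pi}" for \<theta> :: real
  proof -
    have s: "sin \<theta> > 0" using that by (auto intro: sin_gt_zero)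
    have "(cos \<theta>)\<^sup>2 = 1 - (sin \<theta>)\<^sup>2" by (rule cos_squared_eq)
    then have 1: "1 + (cot \<theta>)\<^sup>2 = 1 / (sin \<theta>)\<^sup>2"
      using s by (simp add: cot_def power_divide field_simps)
    have 2: "sqrt (1 / (sin \<theta>)\<^sup>2) = 1 / sin \<theta>" using s by (simp add: real_sqrt_divide)
    show ?thesis using s unfolding F_def 1 2
      by (simp add: cot_def power_divide field_simps power2_eq_square)
  qed
  have inj: "inj_on cot {0<..<pi::real}"
  proof (rule inj_onI)
    fix x y :: real assume xy: "x \<in> {0<..<pi}" "y \<in> {0<..<pi}" "cot x = cot y"
    then have "sin x > 0" "sin y > 0" by (auto intro: sin_gt_zero)
    with xy have "sin (x - y) = 0" by (simp add: cot_def sin_diff field_simps)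
    moreover have "\<bar>x - y\<bar> < pi" using xy by auto
    ultimately show "x = y" using sin_eq_0_pi[of "x - y"] by auto
  qed
  have img: "cot ` {0<..<pi::real} = UNIV"
  proof -
    have "cot (arccos (s / sqrt (1 + s\<^sup>2))) = s \<and> arccos (s / sqrt (1 + s\<^sup>2)) \<in> {0<..<pi}" for s :: real
    proof -
      have p: "1 + s\<^sup>2 > 0" by (smt (verit) zero_le_power2)
      have "\<bar>s\<bar> < sqrt (1 + s\<^sup>2)" by (rule real_less_rsqrt) simp
      then have b: "\<bar>s / sqrt (1 + s\<^sup>2)\<bar> < 1" using p by (simp add: abs_divide)
      have b': "-1 < s / sqrt (1 + s\<^sup>2)" "s / sqrt (1 + s\<^sup>2) < 1" using b unfolding abs_less_iff by linarith+
      have "1 - (s / sqrt (1 + s\<^sup>2))\<^sup>2 = 1 / (1 + s\<^sup>2)"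
        using p by (simp add: power_divide field_simps)
      then have "sin (arccos (s / sqrt (1 + s\<^sup>2))) = 1 / sqrt (1 + s\<^sup>2)"
        using b' by (simp add: sin_arccos real_sqrt_divide)
      then show ?thesis
        using b' p arccos_lt_bounded[OF b'] by (simp add: cot_def cos_arccos)
    qed
    then show ?thesis by (metis UNIV_eq_I image_eqI)
  qed
  \<comment> \<open>The change of variables yields integrability and value together, for an
    arbitrary \<open>b\<close>; in the end \<open>b\<close> is the integral over the closed
    interval.\<close>
  have eq: "(\<lambda>\<theta>. h (cos \<theta>) * (sin \<theta>)\<^sup>2) absolutely_integrable_on {0<..<pi} \<and>
      integral {0<..<pi} (\<lambda>\<theta>. h (cos \<theta>) * (sin \<theta>)\<^sup>2) = b
      \<longleftrightarrow> F absolutely_integrable_on UNIV \<and> integral UNIV F = b" for b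
  proof -
    have "(\<lambda>\<theta>. \<bar>- inverse ((sin \<theta>)\<^sup>2)\<bar> * F (cot \<theta>)) absolutely_integrable_on {0<..<pi} \<and>
      integral {0<..<pi} (\<lambda>\<theta>. \<bar>- inverse ((sin \<theta>)\<^sup>2)\<bar> * F (cot \<theta>)) = b
      \<longleftrightarrow> F absolutely_integrable_on (cot ` {0<..<pi}) \<and> integral (cot ` {0<..<pi}) F = b"
    proof (rule has_absolute_integral_change_of_variables_1'[OF _ _ inj])
      fix x :: real assume "x \<in> {0<..<pi}"
      then have "sin x \<noteq> 0" using sin_gt_zero[of x] by auto
      then show "(cot has_field_derivative - inverse ((sin x)\<^sup>2)) (at x within {0<..<pi})"
        by (intro DERIV_subset[OF DERIV_cot]) auto
    qed auto
    moreover have "(\<lambda>\<theta>. \<bar>- inverse ((sin \<theta>)\<^sup>2)\<bar> * F (cot \<theta>)) absolutely_integrable_on {0<..<pi}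
      \<longleftrightarrow> (\<lambda>\<theta>. h (cos \<theta>) * (sin \<theta>)\<^sup>2) absolutely_integrable_on {0<..<pi}"
      by (intro set_integrable_cong) (use F in auto)
    moreover have "integral {0<..<pi} (\<lambda>\<theta>. \<bar>- inverse ((sin \<theta>)\<^sup>2)\<bar> * F (cot \<theta>)) =
      integral {0<..<pi} (\<lambda>\<theta>. h (cos \<theta>) * (sin \<theta>)\<^sup>2)"
      by (intro integral_cong F)
    ultimately show ?thesis unfolding img by simp
  qed
  have "(\<lambda>\<theta>. h (cos \<theta>) * (sin \<theta>)\<^sup>2) absolutely_integrable_on {0<..<pi}"
    using assms by (rule set_integrable_subset) auto
  moreover have "integral {0<..<pi} (\<lambda>\<theta>. h (cos \<theta>) * (sin \<theta>)\<^sup>2) =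
      integral {0..pi} (\<lambda>\<theta>. h (cos \<theta>) * (sin \<theta>)\<^sup>2)"
    by (simp add: integral_open_interval_real)
  ultimately show "(\<lambda>s. h (s / sqrt (1 + s\<^sup>2)) * (1 / (1 + s\<^sup>2)\<^sup>2)) absolutely_integrable_on UNIV"
    "integral UNIV (\<lambda>s. h (s / sqrt (1 + s\<^sup>2)) * (1 / (1 + s\<^sup>2)\<^sup>2)) =
      integral {0..pi} (\<lambda>\<theta>. h (cos \<theta>) * (sin \<theta>)\<^sup>2)"
    using eq[of "integral {0..pi} (\<lambda>\<theta>. h (cos \<theta>) * (sin \<theta>)\<^sup>2)"] unfolding F_def by auto
qed

lemma has_integral_sin_squared: "((\<lambda>\<theta>. (sin \<theta>)\<^sup>2) has_integral pi / 2) {0..pi}"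
proof -
  have "((\<lambda>\<theta>. (sin \<theta>)\<^sup>2) has_integral (pi - sin pi * cos pi) / 2 - (0 - sin 0 * cos 0) / 2) {0..pi}"
  proof (rule fundamental_theorem_of_calculus)
    fix x :: real
    have "((\<lambda>x. (x - sin x * cos x) / 2) has_real_derivative (1 - (cos x * cos x - sin x * sin x)) / 2)
        (at x within {0..pi})"
      by (auto intro!: derivative_eq_intros)
    moreover have "(1 - (cos x * cos x - sin x * sin x)) / 2 = (sin x)\<^sup>2"
      using sin_cos_squared_add[of x] by (simp add: power2_eq_square field_simps)
    ultimately show "((\<lambda>x. (x - sin x * cos x) / 2) has_vector_derivative (sin x)\<^sup>2) (at x within {0..pi})"
      by (simp add: has_real_derivative_iff_has_vector_derivative)
  qed simp
  then show ?thesis by simp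
qed

text \<open>The constant \<open>c\<close> of the cone formula is never computed. Taking h = 1 gives
  the volume of the ball as c pi / 2, so \<open>c\<close> cancels in the quotient and 2 / pi appears
  as the reciprocal of the integral of sin^2.\<close>

lemma integral_quat_ball_cone:
  fixes h :: "real \<Rightarrow> real"
  assumes [measurable]: "h \<in> borel_measurable borel"
    and int: "(\<lambda>\<theta>. h (cos \<theta>) * (sin \<theta>)\<^sup>2) absolutely_integrable_on {0..pi}"
  shows "set_integrable lborel (ball (0::quat) 1) (\<lambda>x. h (x $ 1 / norm x))"
    and "(LINT x:ball (0::quat) 1|lborel. h (x $ 1 / norm x)) / measure lborel (ball (0::quat) 1)
      = 2 / pi * integral {0..pi} (\<lambda>\<theta>. h (cos \<theta>) * (sin \<theta>)\<^sup>2)"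
proof -
  define B where "B = ball (0::quat) 1"
  have [measurable]: "B \<in> sets borel" by (simp add: B_def)
  have [measurable]: "(\<lambda>x::quat. x $ 1 / norm x) \<in> borel_measurable borel"
    by (intro borel_measurable_divide borel_measurable_continuous_onI continuous_intros)
  define C where "C = (\<integral>\<^sup>+y\<in>ball (0::real \<times> real \<times> real) 1. ennreal (norm y) \<partial>lborel)"
  have "C \<le> (\<integral>\<^sup>+y. indicator (ball (0::real \<times> real \<times> real) 1) y \<partial>lborel)"
    unfolding C_def by (intro nn_integral_mono) (auto split: split_indicator intro!: ennreal_leI simp: ennreal_le_1)
  also have "\<dots> = emeasure lborel (ball (0::real \<times> real \<times> real) 1)"
    by simp
  also have "\<dots> < \<infinity>"
    by (rule emeasure_bounded_finite) simp
  finally have "C < \<infinity>" .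
  then obtain c where c: "C = ennreal c" "c \<ge> 0"
    by (cases C) auto
  define W where "W = (\<lambda>s::real. 1 / (1 + s\<^sup>2)\<^sup>2)"
  have [measurable]: "W \<in> borel_measurable borel" unfolding W_def by measurable
  have Wp: "W s \<ge> 0" for s by (simp add: W_def)
  \<comment> \<open>Two measures on the line: the law of Re x / |x| on the ball and the one
    predicted by the cone formula. Their equality carries the formula from nonnegative to signed
    integrands.\<close>
  define N1 where "N1 = distr (density lborel (indicator B)) borel (\<lambda>x. x $ 1 / norm x)"
  define N2 where "N2 = distr (density lborel (\<lambda>s. ennreal (c * W s))) borel (\<lambda>s. s / sqrt (1 + s\<^sup>2))"
  have N: "N1 = N2"
  proof (rule measure_eqI)
    show "sets N1 = sets N2" by (simp add: N1_def N2_def)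
    fix A assume "A \<in> sets N1"
    then have [measurable]: "A \<in> sets borel" by (simp add: N1_def)
    have "emeasure N1 A = (\<integral>\<^sup>+x. indicator A x \<partial>N1)" by (simp add: N1_def)
    also have "\<dots> = (\<integral>\<^sup>+x\<in>B. indicator A (x $ 1 / norm x) \<partial>lborel)"
      unfolding N1_def by (subst nn_integral_distr, measurable)
        (subst nn_integral_density, measurable, simp add: mult.commute)
    also have "\<dots> = C * (\<integral>\<^sup>+s. indicator A (s / sqrt (1 + s\<^sup>2)) * ennreal (W s) \<partial>lborel)"
      unfolding B_def C_def W_def by (rule nn_integral_quat_ball_cone) measurable
    also have "\<dots> = (\<integral>\<^sup>+x. indicator A x \<partial>N2)"
      using c(2) unfolding c(1) N2_def
      by (subst nn_integral_distr, measurable)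
        (subst nn_integral_density, measurable,
         simp add: nn_integral_cmult[symmetric] ennreal_mult Wp mult_ac)
    also have "\<dots> = emeasure N2 A" by (simp add: N2_def)
    finally show "emeasure N1 A = emeasure N2 A" .
  qed
  have gen: "integrable N1 g \<and> integral\<^sup>L N1 g = c * integral {0..pi} (\<lambda>\<theta>. g (cos \<theta>) * (sin \<theta>)\<^sup>2)"
    if [measurable]: "g \<in> borel_measurable borel"
      and gi: "(\<lambda>\<theta>. g (cos \<theta>) * (sin \<theta>)\<^sup>2) absolutely_integrable_on {0..pi}" for g
  proof -
    have ai: "(\<lambda>s. g (s / sqrt (1 + s\<^sup>2)) * W s) absolutely_integrable_on UNIV"
      unfolding W_def by (rule cot_has_absolute_integral[OF gi])
    have i: "integrable lborel (\<lambda>s. g (s / sqrt (1 + s\<^sup>2)) * W s)"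
      using ai by (simp add: set_integrable_def integrable_completion)
    then have i': "integrable lborel (\<lambda>s. (c * W s) *\<^sub>R g (s / sqrt (1 + s\<^sup>2)))"
      by (simp add: mult_ac)
    have pos: "AE s in lborel. 0 \<le> c * W s" using c by (simp add: W_def)
    have "integrable N2 g"
      unfolding N2_def using i' pos by (simp add: integrable_distr_eq integrable_density)
    moreover have "integral\<^sup>L N2 g = c * (\<integral>s. g (s / sqrt (1 + s\<^sup>2)) * W s \<partial>lborel)"
      unfolding N2_def using pos
      by (simp add: integral_distr integral_density mult.assoc mult.commute[of "W _"])
    moreover have "(\<integral>s. g (s / sqrt (1 + s\<^sup>2)) * W s \<partial>lborel) =
        integral {0..pi} (\<lambda>\<theta>. g (cos \<theta>) * (sin \<theta>)\<^sup>2)"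
      using integral_lborel[OF i] cot_has_absolute_integral(2)[OF gi] by (simp only: W_def)
    ultimately show ?thesis unfolding N by simp
  qed
  have N1i: "integrable N1 g \<longleftrightarrow> set_integrable lborel B (\<lambda>x. g (x $ 1 / norm x))"
    "integral\<^sup>L N1 g = (LINT x:B|lborel. g (x $ 1 / norm x))"
    if [measurable]: "g \<in> borel_measurable borel" for g :: "real \<Rightarrow> real"
  proof -
    have e: "density lborel (indicator B) = density lborel (\<lambda>x. ennreal (indicator B x))"
      by (simp add: ennreal_indicator)
    show "integrable N1 g \<longleftrightarrow> set_integrable lborel B (\<lambda>x. g (x $ 1 / norm x))"
      by (simp add: N1_def e integrable_distr_eq integrable_density set_integrable_def)
    show "integral\<^sup>L N1 g = (LINT x:B|lborel. g (x $ 1 / norm x))"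
      by (simp add: N1_def e integral_distr integral_density set_lebesgue_integral_def)
  qed
  have "(\<lambda>\<theta>. (sin \<theta>)\<^sup>2 :: real) absolutely_integrable_on {0..pi}"
    using has_integral_sin_squared
    by (intro nonnegative_absolutely_integrable_1) (auto simp: integrable_on_def)
  then have "(LINT x:B|lborel. 1) = c * (pi / 2)"
    using gen[of "\<lambda>_. 1"] N1i(2)[of "\<lambda>_. 1"] integral_unique[OF has_integral_sin_squared] by simp
  then have m: "measure lborel B = c * (pi / 2)"
    by (simp add: set_lebesgue_integral_def)
  have "0 < measure lborel B"
    unfolding B_def by (simp add: content_ball_pos)
  then have "c > 0" using m c(2) by (cases "c = 0") auto
  show "set_integrable lborel (ball (0::quat) 1) (\<lambda>x. h (x $ 1 / norm x))"
    using gen[of h] N1i(1)[of h] int by (simp add: B_def)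
  show "(LINT x:ball (0::quat) 1|lborel. h (x $ 1 / norm x)) / measure lborel (ball (0::quat) 1)
      = 2 / pi * integral {0..pi} (\<lambda>\<theta>. h (cos \<theta>) * (sin \<theta>)\<^sup>2)"
    using gen[of h] N1i(2)[of h] int \<open>c > 0\<close> unfolding B_def[symmetric] m by simp
qed

section \<open>Integrability of logarithms\<close>

text \<open>Uses - ln x = 2 ln (x powr (-1/2)) \<le> 2 x powr (-1/2); an exponent above -1 keeps the
  bound integrable near 0. Separate \<open>x\<close> and \<open>y\<close> allow the singularity to
  be measured by a simpler lower bound of the argument.\<close>

lemma abs_ln_le:
  fixes x y :: real
  assumes "0 < x" "x \<le> y"
  shows "\<bar>ln y\<bar> \<le> 2 * x powr (-1/2) + y"
proof -
  have "ln y \<le> y" using assms by (intro ln_bound) auto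
  moreover have "- ln y \<le> - ln x" using assms by simp
  moreover have "- ln x = 2 * ln (x powr (-1/2))" using assms by (simp add: ln_powr)
  moreover have "ln (x powr (-1/2)) \<le> x powr (-1/2)" using assms by (intro ln_bound) simp
  moreover have "x powr (-1/2) \<ge> 0" by simp
  ultimately show ?thesis using assms by (simp only: abs_le_iff) linarith
qed

lemma abs_powr_integrable:
  assumes "e > -1"
  shows "(\<lambda>x. \<bar>x - a\<bar> powr e) integrable_on {b..c::real}"
proof -
  define R where "R = \<bar>b - a\<bar> + \<bar>c - a\<bar>"
  have *: "(\<lambda>x. \<bar>x\<bar> powr e) integrable_on {0..R}"
    by (rule integrable_eq[OF integrable_on_powr_from_0[OF assms]]) (auto simp: R_def)
  then have "(\<lambda>x. \<bar>x\<bar> powr e) integrable_on {-R..0}"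
    using Henstock_Kurzweil_Integration.integrable_reflect_real[of "\<lambda>x. \<bar>x\<bar> powr e" R 0] by simp
  with * have "(\<lambda>x. \<bar>x\<bar> powr e) integrable_on {-R..R}"
    by (intro Henstock_Kurzweil_Integration.integrable_combine[of "-R" 0 R]) (auto simp: R_def)
  then have "(\<lambda>x. \<bar>x + (-a)\<bar> powr e) integrable_on {-R-(-a)..R-(-a)}"
    by (rule integrable_shift_real_ivl)
  then have "(\<lambda>x. \<bar>x - a\<bar> powr e) integrable_on {-R + a..R + a}" by simp
  then show ?thesis
    by (rule integrable_on_subinterval) (auto simp: R_def)
qed

text \<open>Factoring out a root $r$, the singularity is controlled by $|z(c) - r| \ge |c - \mathrm{Re}\, r|$.
  The convention $\ln 0 = 0$ makes $|\ln (xy)| \le |\ln x| + |\ln y|$ hold for all $x, y \ge 0$.\<close>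

lemma ln_poly_absolutely_integrable:
  fixes p :: "complex poly" and z :: "real \<Rightarrow> complex"
  assumes z: "continuous_on UNIV z" and Re: "\<And>c. Re (z c) = c" and "p \<noteq> 0"
  shows "(\<lambda>c. ln (cmod (poly p (z c)))) absolutely_integrable_on {a..b}"
  using \<open>p \<noteq> 0\<close>
proof (induction "degree p" arbitrary: p)
  case 0
  then obtain k where "p = [:k:]" by (metis degree_eq_zeroE)
  then show ?case by (simp add: absolutely_integrable_on_const)
next
  case (Suc n)
  have cont: "continuous_on UNIV (\<lambda>c. poly q (z c))" for q :: "complex poly"
    by (intro continuous_on_poly z)
  have meas: "(\<lambda>c. ln (cmod (poly q (z c)))) \<in> borel_measurable (lebesgue_on {a..b})" for q
  proof -
    have [measurable]: "(\<lambda>c. poly q (z c)) \<in> borel_measurable borel"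
      by (rule borel_measurable_continuous_onI[OF cont])
    have "(\<lambda>c. ln (cmod (poly q (z c)))) \<in> borel_measurable borel" by measurable
    then show ?thesis
      by (intro measurable_restrict_space1 measurable_completion) simp
  qed
  obtain r where "poly p r = 0"
    using Suc.hyps(2) fundamental_theorem_of_algebra[of p] constant_degree[of p] by auto
  then obtain q where q: "p = [:-r, 1:] * q" by (auto simp: poly_eq_0_iff_dvd)
  with Suc.prems have q0: "q \<noteq> 0" by auto
  have "degree p = degree [:-r, 1:] + degree q"
    unfolding q by (rule degree_mult_eq) (use q0 in auto)
  with Suc.hyps(2) have "n = degree q" by simp
  then have Q: "(\<lambda>c. ln (cmod (poly q (z c)))) absolutely_integrable_on {a..b}"
    using Suc.hyps(1) q0 by blast
  have L: "(\<lambda>c. ln (cmod (z c - r))) absolutely_integrable_on {a..b}"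
  proof -
    define g where "g c = 2 * \<bar>c - Re r\<bar> powr (-1/2) + cmod (z c - r)" for c
    have g: "g integrable_on {a..b}"
      unfolding g_def
      by (intro integrable_add integrable_on_mult_right abs_powr_integrable integrable_continuous_real
          continuous_intros continuous_on_subset[OF z]) auto
    \<comment> \<open>Since \<open>0 powr e\<close> is 0, the bound \<open>g\<close> may fail at c =
      Re r when \<open>r\<close> is off the curve; changing one value does not affect
      integrability.\<close>
    have g': "(\<lambda>c. if c = Re r then \<bar>ln (cmod (z c - r))\<bar> else g c) integrable_on {a..b}"
      by (rule integrable_spike_finite[OF _ _ g, of "{Re r}"]) auto
    have "norm (ln (cmod (z c - r))) \<le> (if c = Re r then \<bar>ln (cmod (z c - r))\<bar> else g c)" for c
    proof (cases "c = Re r")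
      case False
      have "\<bar>c - Re r\<bar> \<le> cmod (z c - r)"
        using abs_Re_le_cmod[of "z c - r"] by (simp add: Re)
      then show ?thesis using False abs_ln_le[of "\<bar>c - Re r\<bar>" "cmod (z c - r)"]
        by (simp add: g_def)
    qed simp
    then show ?thesis
      using meas[of "[:-r, 1:]"]
      by (intro measurable_bounded_by_integrable_imp_absolutely_integrable[OF _ _ g']) auto
  qed
  have "(\<lambda>c. \<bar>ln (cmod (z c - r))\<bar> + \<bar>ln (cmod (poly q (z c)))\<bar>) integrable_on {a..b}"
    using set_integrable_abs[OF L] set_integrable_abs[OF Q]
    by (intro integrable_add set_lebesgue_integral_eq_integral(1))
  then show ?case
  proof (rule measurable_bounded_by_integrable_imp_absolutely_integrable[OF meas, rotated])
    fix c
    have "poly p (z c) = (z c - r) * poly q (z c)" by (simp add: q algebra_simps)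
    then show "norm (ln (cmod (poly p (z c)))) \<le> \<bar>ln (cmod (z c - r))\<bar> + \<bar>ln (cmod (poly q (z c)))\<bar>"
      by (cases "z c = r"; cases "poly q (z c) = 0") (simp_all add: norm_mult ln_mult)
  qed auto
qed

text \<open>The substitution c = cos \<theta> produces h (cos \<theta>) |sin \<theta>|; the other
  factor |sin \<theta>| is at most 1, so domination finishes the argument.\<close>

lemma absolutely_integrable_cos_sin_squared:
  fixes h :: "real \<Rightarrow> real"
  assumes [measurable]: "h \<in> borel_measurable borel" and "h absolutely_integrable_on {-1..1}"
  shows "(\<lambda>\<theta>. h (cos \<theta>) * (sin \<theta>)\<^sup>2) absolutely_integrable_on {0..pi}"
proof -
  have img: "cos ` {0..pi} = {-1..1::real}"
  proof -
    have "c \<in> cos ` {0..pi}" if "c \<in> {-1..1}" for c :: real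
      using that by (intro image_eqI[of _ _ "arccos c"]) (auto simp: arccos_lbound arccos_ubound)
    then show ?thesis by auto
  qed
  have "h absolutely_integrable_on cos ` {0..pi} \<longleftrightarrow>
      (\<lambda>\<theta>. \<bar>- sin \<theta>\<bar> * h (cos \<theta>)) absolutely_integrable_on {0..pi}"
  proof (rule absolutely_integrable_change_of_variables_1')
    show "(cos has_field_derivative - sin \<theta>) (at \<theta> within {0..pi})" for \<theta> :: real
      by (intro DERIV_subset[OF DERIV_cos]) simp
    show "inj_on cos {0..pi::real}" by (intro inj_onI) (simp add: cos_inj_pi)
  qed simp
  with assms(2) have "(\<lambda>\<theta>. \<bar>- sin \<theta>\<bar> * h (cos \<theta>)) absolutely_integrable_on {0..pi}"
    unfolding img by simp
  then have "(\<lambda>\<theta>. \<bar>\<bar>- sin \<theta>\<bar> * h (cos \<theta>)\<bar>) integrable_on {0..pi}"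
    by (intro set_lebesgue_integral_eq_integral(1) set_integrable_abs)
  then show ?thesis
  proof (rule measurable_bounded_by_integrable_imp_absolutely_integrable[rotated 2])
    have "(\<lambda>\<theta>. h (cos \<theta>) * (sin \<theta>)\<^sup>2) \<in> borel_measurable borel" by measurable
    then show "(\<lambda>\<theta>. h (cos \<theta>) * (sin \<theta>)\<^sup>2) \<in> borel_measurable (lebesgue_on {0..pi})"
      by (intro measurable_restrict_space1 measurable_completion) simp
    fix \<theta> :: real
    have "\<bar>sin \<theta>\<bar> * \<bar>sin \<theta>\<bar> \<le> \<bar>sin \<theta>\<bar> * 1" by (intro mult_left_mono) auto
    then show "norm (h (cos \<theta>) * (sin \<theta>)\<^sup>2) \<le> \<bar>\<bar>- sin \<theta>\<bar> * h (cos \<theta>)\<bar>"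
      using mult_right_mono[of "\<bar>sin \<theta>\<bar> * \<bar>sin \<theta>\<bar>" "\<bar>sin \<theta>\<bar>" "\<bar>h (cos \<theta>)\<bar>"]
      by (simp only: real_norm_def abs_mult power2_eq_square abs_minus_cancel abs_abs mult.commute mult_1_right)
  qed auto
qed

lemma set_nn_integral_ln_finite: "(\<integral>\<^sup>+s\<in>{-1..1}. ennreal (- ln (\<bar>s\<bar> / 2)) \<partial>lborel) < \<infinity>"
proof -
  \<comment> \<open>The bound of \<open>abs_ln_le\<close> with both arguments |s|, plus ln 2 from
    the halving; \<open>s - 0\<close> fits the form of \<open>abs_powr_integrable\<close>.\<close>
  define g :: "real \<Rightarrow> real" where "g s = 2 * \<bar>s - 0\<bar> powr (-1/2) + (\<bar>s\<bar> + ln 2)" for s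
  have "g integrable_on {-1..1}"
    unfolding g_def
    by (intro integrable_add integrable_on_mult_right abs_powr_integrable integrable_continuous_real
        continuous_intros) auto
  then have "g absolutely_integrable_on {-1..1}"
    by (rule nonnegative_absolutely_integrable_1) (auto simp: g_def)
  then have "integrable lborel (\<lambda>s. indicator {-1..1} s *\<^sub>R g s)"
    unfolding set_integrable_def by (subst (asm) integrable_completion) (auto simp: g_def)
  then have "(\<integral>\<^sup>+s. ennreal (norm (indicator {-1..1} s *\<^sub>R g s)) \<partial>lborel) < \<infinity>"
    by (simp add: integrable_iff_bounded)
  moreover have "(\<integral>\<^sup>+s\<in>{-1..1}. ennreal (- ln (\<bar>s\<bar> / 2)) \<partial>lborel)
      \<le> (\<integral>\<^sup>+s. ennreal (norm (indicator {-1..1} s *\<^sub>R g s)) \<partial>lborel)"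
  proof (intro nn_integral_mono)
    fix s :: real
    have "- ln (\<bar>s\<bar> / 2) \<le> g s"
    proof (cases "s = 0")
      case False
      then show ?thesis using abs_ln_le[of "\<bar>s\<bar>" "\<bar>s\<bar>"] by (simp add: g_def ln_div)
    qed (simp add: g_def)
    then show "ennreal (- ln (\<bar>s\<bar> / 2)) * indicator {-1..1} s \<le> ennreal (norm (indicator {-1..1} s *\<^sub>R g s))"
      by (auto split: split_indicator intro!: ennreal_leI)
  qed
  ultimately show ?thesis by (rule le_less_trans[rotated])
qed

section \<open>Growth of star powers\<close>

lemma continuous_on_qmult:
  assumes "continuous_on S f" "continuous_on S g"
  shows "continuous_on S (\<lambda>x. qmult (f x) (g x))"
proof -
  have qmk: "continuous_on S (\<lambda>x. qmk (a x) (b x) (c x) (d x))"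
    if "continuous_on S a" "continuous_on S b" "continuous_on S c" "continuous_on S d"
    for a b c d :: "'a \<Rightarrow> real"
    unfolding qmk_def
  proof (rule continuous_on_vec_lambda)
    fix i :: 4
    show "continuous_on S (\<lambda>x. if i = 1 then a x else if i = 2 then b x else if i = 3 then c x else d x)"
      by (cases "i = 1"; cases "i = 2"; cases "i = 3") (simp_all add: that)
  qed
  show ?thesis unfolding qmult_def
    by (intro qmk continuous_intros assms)
qed

lemma borel_measurable_qeval [measurable]: "qeval a \<in> borel_measurable borel"
proof (rule borel_measurable_continuous_onI)
  have "continuous_on UNIV (\<lambda>x. qpow x l)" for l
    by (induction l) (auto intro: continuous_on_qmult)
  then show "continuous_on UNIV (qeval a)"
    unfolding qeval_def[abs_def] by (intro continuous_on_sum continuous_on_qmult continuous_on_const) auto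
qed

text \<open>The cone formula for the indicator of \<open>Z\<close>: the map s / sqrt (1 + s^2) is
  injective, so only finitely many slopes s are hit. This discards the points where u or v
  vanishes.\<close>

lemma AE_quat_ball_cone:
  assumes "finite Z"
  shows "AE x in lborel. x \<in> ball (0::quat) 1 \<longrightarrow> x $ 1 / norm x \<notin> Z"
proof -
  have [measurable]: "Z \<in> sets borel"
    using assms by (intro borel_closed finite_imp_closed)
  have [measurable]: "(\<lambda>x::quat. x $ 1 / norm x) \<in> borel_measurable borel"
    by (intro borel_measurable_divide borel_measurable_continuous_onI continuous_intros)
  have "inj (\<lambda>s::real. s / sqrt (1 + s\<^sup>2))"
  proof (rule inj_on_inverseI)
    fix s :: real
    have p: "1 + s\<^sup>2 > 0" by (smt (verit) zero_le_power2)
    have "1 - (s / sqrt (1 + s\<^sup>2))\<^sup>2 = 1 / (1 + s\<^sup>2)"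
      using p by (simp add: power_divide field_simps)
    then show "(\<lambda>r. r / sqrt (1 - r\<^sup>2)) (s / sqrt (1 + s\<^sup>2)) = s"
      using p by (simp add: real_sqrt_divide)
  qed
  then have "finite ((\<lambda>s::real. s / sqrt (1 + s\<^sup>2)) -` Z)"
    using assms by (rule finite_vimageI[rotated])
  then have "AE s in lborel. s \<notin> (\<lambda>s::real. s / sqrt (1 + s\<^sup>2)) -` Z"
    by (intro AE_not_in countable_imp_null_set_lborel countable_finite)
  then have "(\<integral>\<^sup>+s. indicator Z (s / sqrt (1 + s\<^sup>2)) * ennreal (1 / (1 + s\<^sup>2)\<^sup>2) \<partial>lborel) = (\<integral>\<^sup>+(s::real). 0 \<partial>lborel)"
    by (intro nn_integral_cong_AE) (auto elim!: eventually_mono split: split_indicator)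
  then have "(\<integral>\<^sup>+x\<in>ball (0::quat) 1. indicator Z (x $ 1 / norm x) \<partial>lborel) = 0"
    by (subst nn_integral_quat_ball_cone) simp_all
  then show ?thesis
    by (subst (asm) nn_integral_0_iff_AE) (auto elim!: eventually_mono split: split_indicator_asm)
qed

text \<open>Serves both limits: \<open>F n\<close> is a positive or negative star power and
  \<open>h\<close> is ln max or - ln min as a function of the real part. Integrability of ln |F n|
  comes out of the proof, as the sum of an integrable function of the real part and a dominated
  remainder.\<close>

lemma mH_div_tendsto:
  fixes w :: quat and h :: "real \<Rightarrow> real" and F :: "nat \<Rightarrow> quat \<Rightarrow> quat"
  assumes w: "norm w = 1"
    and [measurable]: "h \<in> borel_measurable borel"
    and int: "(\<lambda>\<theta>. h (cos \<theta>) * (sin \<theta>)\<^sup>2) absolutely_integrable_on {0..pi}"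
    and meas [measurable]: "\<And>n. (\<lambda>x. norm (F n x)) \<in> borel_measurable borel"
    and bound: "\<And>n. AE x in lborel. x \<in> ball 0 1 \<longrightarrow>
      \<bar>ln (norm (F n (x /\<^sub>R norm x))) - real n * h (x $ 1 / norm x)\<bar> \<le> - ln (\<bar>x \<bullet> w\<bar> / 2)"
  shows "(\<lambda>n. mH (F n) / real n) \<longlonglongrightarrow> 2 / pi * integral {0..pi} (\<lambda>\<theta>. h (cos \<theta>) * (sin \<theta>)\<^sup>2)"
proof -
  define B where "B = ball (0::quat) 1"
  have [measurable]: "B \<in> sets borel" by (simp add: B_def)
  define G where "G x = - ln (\<bar>x \<bullet> w\<bar> / 2)" for x
  have [measurable]: "G \<in> borel_measurable borel"
    unfolding G_def by measurable
  define V where "V = measure lborel B"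
  have V: "V > 0" unfolding V_def B_def by (simp add: content_ball_pos)
  have [measurable]: "(\<lambda>x::quat. x $ 1 / norm x) \<in> borel_measurable borel"
    by (intro borel_measurable_divide borel_measurable_continuous_onI continuous_intros)
  have Gpos: "G x \<ge> 0" if "x \<in> B" for x
  proof (cases "x \<bullet> w = 0")
    case False
    have "\<bar>x \<bullet> w\<bar> \<le> norm x" using Cauchy_Schwarz_ineq2[of x w] w by simp
    also have "\<dots> \<le> 1" using that by (simp add: B_def)
    finally show ?thesis using False by (simp add: G_def)
  qed (simp add: G_def)
  have G: "set_integrable lborel B G"
  proof -
    have "(\<integral>\<^sup>+x. ennreal (norm (indicator B x *\<^sub>R G x)) \<partial>lborel) = (\<integral>\<^sup>+x\<in>B. ennreal (- ln (\<bar>x \<bullet> w\<bar> / 2)) \<partial>lborel)"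
      by (intro nn_integral_cong) (auto simp: Gpos split: split_indicator simp flip: G_def)
    also have "\<dots> \<le> emeasure lborel (ball (0::quat) 2) * (\<integral>\<^sup>+s\<in>{-1..1}. ennreal (- ln (\<bar>s\<bar> / 2)) \<partial>lborel)"
      unfolding B_def by (rule nn_integral_ball_inner_le) (use w in measurable)
    also have "\<dots> < \<infinity>"
      using set_nn_integral_ln_finite emeasure_bounded_finite[of "ball (0::quat) 2"]
      by (simp add: ennreal_mult_less_top)
    finally show ?thesis
      unfolding set_integrable_def by (subst integrable_iff_bounded) auto
  qed
  define L where "L n x = ln (norm (F n (x /\<^sub>R norm x)))" for n x
  have [measurable]: "L n \<in> borel_measurable borel" for n
  proof -
    have [measurable]: "(\<lambda>x::quat. x /\<^sub>R norm x) \<in> borel_measurable borel" by measurable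
    have "(\<lambda>x. norm (F n (x /\<^sub>R norm x))) \<in> borel_measurable borel"
      using measurable_compose[OF _ meas, of "\<lambda>x. x /\<^sub>R norm x" borel n] by simp
    then show ?thesis unfolding L_def by measurable
  qed
  define H where "H x = h (x $ 1 / norm x)" for x :: quat
  have [measurable]: "H \<in> borel_measurable borel" unfolding H_def by measurable
  have H: "set_integrable lborel B H" "(LINT x:B|lborel. H x) / V = 2 / pi * integral {0..pi} (\<lambda>\<theta>. h (cos \<theta>) * (sin \<theta>)\<^sup>2)"
    unfolding H_def B_def V_def using integral_quat_ball_cone[OF _ int] by simp_all
  have D: "set_integrable lborel B (\<lambda>x. L n x - real n * H x)"
    and Dle: "\<bar>LINT x:B|lborel. L n x - real n * H x\<bar> \<le> (LINT x:B|lborel. G x)" for n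
  proof -
    have AE: "AE x in lborel. norm (indicator B x *\<^sub>R (L n x - real n * H x)) \<le> indicator B x *\<^sub>R G x"
      using bound[of n] by (auto elim!: eventually_mono simp: B_def L_def H_def G_def split: split_indicator)
    show "set_integrable lborel B (\<lambda>x. L n x - real n * H x)"
      unfolding set_integrable_def
      by (rule Bochner_Integration.integrable_bound[OF G[unfolded set_integrable_def]])
         (use AE in \<open>auto elim!: eventually_mono\<close>)
    then have "integrable lborel (\<lambda>x. norm (indicator B x *\<^sub>R (L n x - real n * H x)))"
      unfolding set_integrable_def by (rule integrable_norm)
    from integral_mono_AE[OF this G[unfolded set_integrable_def] AE]
    show "\<bar>LINT x:B|lborel. L n x - real n * H x\<bar> \<le> (LINT x:B|lborel. G x)"
      unfolding set_lebesgue_integral_def real_norm_def[symmetric]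
      by (rule order_trans[OF integral_norm_bound])
  qed
  have diff: "mH (F n) / real n - (LINT x:B|lborel. H x) / V = (LINT x:B|lborel. L n x - real n * H x) / V / real n"
    if "n > 0" for n
  proof -
    have "set_integrable lborel B (\<lambda>x. real n * H x)" using H(1) by simp
    from set_integral_add(2)[OF D[of n] this]
    have "(LINT x:B|lborel. L n x) = (LINT x:B|lborel. L n x - real n * H x) + real n * (LINT x:B|lborel. H x)"
      by simp
    moreover have "mH (F n) = (LINT x:B|lborel. L n x) / V"
      unfolding mH_def L_def B_def V_def ..
    ultimately show ?thesis
      using that V by (simp add: field_simps)
  qed
  have "(\<lambda>n. mH (F n) / real n - (LINT x:B|lborel. H x) / V) \<longlonglongrightarrow> 0"
  proof (rule Lim_null_comparison)
    show "\<forall>\<^sub>F n in sequentially. norm (mH (F n) / real n - (LINT x:B|lborel. H x) / V)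
        \<le> (LINT x:B|lborel. G x) / V / real n"
      using eventually_gt_at_top[of 0]
    proof eventually_elim
      case (elim n)
      then show ?case using Dle[of n] V
        by (simp only: diff) (simp add: divide_right_mono abs_divide)
    qed
    show "(\<lambda>n. (LINT x:B|lborel. G x) / V / real n) \<longlonglongrightarrow> 0"
      by (rule lim_const_over_n)
  qed
  then show ?thesis unfolding H(2) by (rule LIM_zero_cancel)
qed

text \<open>If $t = \langle J, I\rangle$ and $d$ is the component of the point along a direction orthogonal to
  $1$ and $I$, both weights $(1 \pm t)/2$ are at least $d^2/4$.\<close>

lemma abs_ln_weighted_le:
  fixes A B d t y :: real
  assumes y: "y\<^sup>2 = (1 + t) / 2 * A\<^sup>2 + (1 - t) / 2 * B\<^sup>2" "y \<ge> 0"
    and A: "A \<ge> 0" "B \<ge> 0" "max A B > 0" and d: "d > 0" "t\<^sup>2 + d\<^sup>2 \<le> 1"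
  shows "\<bar>ln y - ln (max A B)\<bar> \<le> - ln (d / 2)"
proof -
  define M where "M = max A B"
  have AM: "A\<^sup>2 \<le> M\<^sup>2" "B\<^sup>2 \<le> M\<^sup>2" using A by (auto simp: M_def intro!: power_mono)
  have t1: "t\<^sup>2 \<le> 1" using d(2) by (smt (verit) zero_le_power2)
  then have t: "-1 \<le> t" "t \<le> 1" by (auto simp: abs_square_le_1 abs_le_iff)
  \<comment> \<open>Each factor of 1 - t^2 is at most 2, so d^2 is at most twice the other factor;
    this is the origin of d / 2.\<close>
  have "d\<^sup>2 \<le> (1 - t) * (1 + t)" using d by (simp add: algebra_simps power2_eq_square)
  moreover have "(1 - t) * (1 + t) \<le> (1 - t) * 2" "(1 - t) * (1 + t) \<le> 2 * (1 + t)"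
    using t by (intro mult_left_mono mult_right_mono; simp)+
  ultimately have dt: "(d / 2)\<^sup>2 \<le> (1 - t) / 2" "(d / 2)\<^sup>2 \<le> (1 + t) / 2"
    by (auto simp: power_divide)
  have "y\<^sup>2 \<le> (1 + t) / 2 * M\<^sup>2 + (1 - t) / 2 * M\<^sup>2"
    unfolding y using t AM by (intro add_mono mult_left_mono) auto
  also have "\<dots> = ((1 + t) / 2 + (1 - t) / 2) * M\<^sup>2" by (rule distrib_right[symmetric])
  also have "(1 + t) / 2 + (1 - t) / 2 = 1" by (simp add: field_simps)
  finally have "y\<^sup>2 \<le> M\<^sup>2" by simp
  moreover have "M > 0" using A by (simp add: M_def)
  ultimately have up: "y \<le> M" by (rule power2_le_imp_le[OF _ less_imp_le])
  have "(d / 2)\<^sup>2 * M\<^sup>2 \<le> y\<^sup>2"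
  proof (cases "A \<ge> B")
    case True
    then have "M = A" by (simp add: M_def)
    moreover have "(d / 2)\<^sup>2 * A\<^sup>2 \<le> (1 + t) / 2 * A\<^sup>2" using dt by (intro mult_right_mono) auto
    moreover have "0 \<le> (1 - t) / 2 * B\<^sup>2" using t by simp
    ultimately show ?thesis unfolding y by simp
  next
    case False
    then have "M = B" by (simp add: M_def)
    moreover have "(d / 2)\<^sup>2 * B\<^sup>2 \<le> (1 - t) / 2 * B\<^sup>2" using dt by (intro mult_right_mono) auto
    moreover have "0 \<le> (1 + t) / 2 * A\<^sup>2" using t by simp
    ultimately show ?thesis unfolding y by simp
  qed
  then have "(d / 2 * M)\<^sup>2 \<le> y\<^sup>2" by (simp only: power_mult_distrib)
  then have low: "d / 2 * M \<le> y" using y(2) by (rule power2_le_imp_le)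
  have M: "M > 0" using A by (simp add: M_def)
  then have "0 < d / 2 * M" using d by simp
  then have "0 < y" using low by linarith
  have "ln (d / 2 * M) \<le> ln y" using \<open>0 < d / 2 * M\<close> low \<open>0 < y\<close> by (simp only: ln_le_cancel_iff)
  moreover have "ln (d / 2 * M) = ln (d / 2) + ln M"
    using d M by (intro ln_mult_pos) auto
  moreover have "ln y \<le> ln M" using up \<open>0 < y\<close> M by simp
  \<comment> \<open>The upper estimate is ln y - ln M \<le> 0; the sign of ln (d / 2) lets one bound
    cover both directions.\<close>
  moreover have "ln (d / 2) \<le> 0"
  proof -
    have "d\<^sup>2 \<le> 1\<^sup>2" using d(2) zero_le_power2[of t] by (simp only: one_power2)
    then have "d \<le> 1" by (rule power2_le_imp_le) simp
    then show ?thesis using d by simp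
  qed
  ultimately show ?thesis unfolding M_def[symmetric] by linarith
qed

section \<open>Points of the unit sphere relative to the slice of \<open>I\<close>\<close>

definition upper_pt :: "real \<Rightarrow> complex" where
  "upper_pt c = of_real c + \<i> * of_real (sqrt (1 - c\<^sup>2))"

lemma upper_pt_cos: "\<theta> \<in> {0..pi} \<Longrightarrow> upper_pt (cos \<theta>) = cis \<theta>"
  using sin_ge_zero[of \<theta>] by (simp add: upper_pt_def complex_eq_iff flip: sin_squared_eq)

lemma Re_upper_pt [simp]: "Re (upper_pt c) = c"
  by (simp add: upper_pt_def)

text \<open>Holds beyond [-1, 1] because \<open>sqrt\<close> extends to negative numbers as an odd
  function. \<open>ln_poly_absolutely_integrable\<close> asks for a curve that is continuous on the
  whole line.\<close>

lemma continuous_on_upper_pt: "continuous_on S upper_pt"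
  unfolding upper_pt_def[abs_def] by (intro continuous_intros)

lemma exists_imag_unit_orthogonal:
  obtains w :: quat where "norm w = 1" "w $ 1 = 0" "w \<bullet> I = 0"
proof (cases "I $ 2 = 0 \<and> I $ 3 = 0")
  case True
  show thesis
    by (rule that[of "qmk 0 1 0 0"]) (use True in \<open>auto simp: quat_inner norm_eq_1\<close>)
next
  case False
  \<comment> \<open>A quarter turn of the i and j components of \<open>I\<close>; when these vanish,
    the unit i itself is orthogonal to \<open>I\<close>.\<close>
  define v where "v = qmk 0 (- I $ 3) (I $ 2) 0"
  have "v \<noteq> 0" using False by (auto simp: v_def quat_eq_iff)
  then show thesis
    by (intro that[of "v /\<^sub>R norm v"]) (simp_all add: v_def quat_inner)
qed

text \<open>\<open>J\<close> is the direction of the imaginary part of \<open>X\<close>, which is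
  nonzero because \<open>w\<close> is purely imaginary and X \<bullet> w \<noteq> 0. That part has
  length s \<le> 1, so X \<bullet> w = s (J \<bullet> w) is no larger than J \<bullet> w in absolute
  value.\<close>

lemma sphere_slice_decomposition:
  assumes I: "I \<in> unit_imag" and w: "norm w = 1" "w $ 1 = 0" "w \<bullet> I = 0"
    and X: "norm X = 1" "X \<bullet> w \<noteq> 0"
  obtains J where "J \<in> unit_imag" "X = slice_emb J (upper_pt (X $ 1))" "(J \<bullet> I)\<^sup>2 + (X \<bullet> w)\<^sup>2 \<le> 1"
proof -
  define s where "s = sqrt (1 - (X $ 1)\<^sup>2)"
  have e: "1 - (X $ 1)\<^sup>2 = (X $ 2)\<^sup>2 + (X $ 3)\<^sup>2 + (X $ 4)\<^sup>2"
    using quat_norm_sq[of X] X by simp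
  then have s2: "s\<^sup>2 = (X $ 2)\<^sup>2 + (X $ 3)\<^sup>2 + (X $ 4)\<^sup>2" by (simp add: s_def)
  have "s \<noteq> 0"
  proof
    assume "s = 0"
    then have "X $ 2 = 0" "X $ 3 = 0" "X $ 4 = 0"
      using s2 zero_le_power2[of "X $ 2"] zero_le_power2[of "X $ 3"] zero_le_power2[of "X $ 4"]
      by (smt (verit) power2_eq_iff zero_eq_power2)+
    then show False using X w by (simp add: quat_inner)
  qed
  moreover have "s \<ge> 0" unfolding s_def e by simp
  ultimately have s: "s > 0" by simp
  have s1: "s \<le> 1" unfolding s_def by (simp add: real_le_lsqrt)
  define J where "J = (X - qreal (X $ 1)) /\<^sub>R s"
  have J1: "J $ 1 = 0" by (simp add: J_def qreal_def)
  have "(J $ 2)\<^sup>2 + (J $ 3)\<^sup>2 + (J $ 4)\<^sup>2 = (inverse s)\<^sup>2 * s\<^sup>2"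
    unfolding s2 by (simp add: J_def qreal_def power_mult_distrib ring_distribs)
  also have "\<dots> = 1" using s by (simp add: field_simps)
  finally have "(J $ 2)\<^sup>2 + (J $ 3)\<^sup>2 + (J $ 4)\<^sup>2 = 1" .
  with J1 have J: "J \<in> unit_imag" by (simp add: unit_imag_iff)
  have XJ: "X = slice_emb J (upper_pt (X $ 1))"
    using s by (simp add: slice_emb_def upper_pt_def s_def[symmetric] J_def)
  have JJ: "J \<bullet> J = 1" "I \<bullet> I = 1" "w \<bullet> w = 1"
    using J I w by (auto simp: unit_imag_def norm_eq_1)
  \<comment> \<open>Bessel's inequality for \<open>J\<close> and the orthonormal pair
    \<open>I\<close>, \<open>w\<close>, read off from the remainder \<open>K\<close>.\<close>
  define K where "K = J - (J \<bullet> I) *\<^sub>R I - (J \<bullet> w) *\<^sub>R w"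
  have "0 \<le> K \<bullet> K" by simp
  also have "K \<bullet> K = 1 - (J \<bullet> I)\<^sup>2 - (J \<bullet> w)\<^sup>2"
    using w(3) by (simp add: K_def inner_diff_left inner_diff_right JJ inner_commute power2_eq_square)
  finally have "(J \<bullet> I)\<^sup>2 + (J \<bullet> w)\<^sup>2 \<le> 1" by simp
  moreover have "(X \<bullet> w)\<^sup>2 \<le> (J \<bullet> w)\<^sup>2"
  proof -
    have "X \<bullet> w = s * (J \<bullet> w)"
      using s w(2) by (simp add: J_def inner_diff_left) (simp add: qreal_def quat_inner)
    then have "\<bar>X \<bullet> w\<bar> \<le> \<bar>J \<bullet> w\<bar>"
      using s s1 by (simp add: abs_mult mult_left_le_one_le)
    then show ?thesis by (simp add: abs_le_square_iff)
  qed
  ultimately show thesis using that[OF J XJ] by simp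
qed

section \<open>Pointwise bounds for star powers and the two limits\<close>

lemma norm_qnegstarpow_eval:
  "norm (qnegstarpow_eval a m x) =
     norm (qeval (qstarpow (qpcnj a) m) x) / norm (qeval (qsym a) x) ^ m"
  by (simp add: qnegstarpow_eval_def norm_qmult norm_qinv norm_qpow power_inverse divide_inverse mult.commute)

context
  fixes I :: quat
  assumes I: "I \<in> unit_imag"
begin

text \<open>Both estimates apply \<open>abs_ln_weighted_le\<close> with d = |X \<bullet> w|, once to
  powers of u and v and once to powers of their inverses. The larger inverse is the inverse of the
  smaller value, which is how min and the sign enter.\<close>

lemma qeval_on_sphere_bounds:
  assumes w: "norm w = 1" "w $ 1 = 0" "w \<bullet> I = 0"
    and X: "norm X = 1" "X \<bullet> w \<noteq> 0"
    and u: "u = cmod (poly p (upper_pt (X $ 1)))" "u > 0"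
    and v: "v = cmod (poly p (cnj (upper_pt (X $ 1))))" "v > 0"
  shows "\<bar>ln (norm (qeval (qstarpow (\<lambda>l. slice_emb I (coeff p l)) n) X)) - real n * ln (max u v)\<bar>
      \<le> - ln (\<bar>X \<bullet> w\<bar> / 2)"
    and "\<bar>ln (norm (qnegstarpow_eval (\<lambda>l. slice_emb I (coeff p l)) n X)) - real n * (- ln (min u v))\<bar>
      \<le> - ln (\<bar>X \<bullet> w\<bar> / 2)"
proof -
  let ?a = "\<lambda>l. slice_emb I (coeff p l)"
  obtain J where J: "J \<in> unit_imag" and XJ: "X = slice_emb J (upper_pt (X $ 1))"
    and le: "(J \<bullet> I)\<^sup>2 + (X \<bullet> w)\<^sup>2 \<le> 1"
    using sphere_slice_decomposition[OF I w X] .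
  define t where "t = J \<bullet> I"
  define z where "z = upper_pt (X $ 1)"
  have N: "(norm (qeval (\<lambda>l. slice_emb I (coeff q l)) X))\<^sup>2 =
      (1 + t) / 2 * (cmod (poly q z))\<^sup>2 + (1 - t) / 2 * (cmod (poly q (cnj z)))\<^sup>2" for q
    by (subst XJ) (simp only: qeval_slice_norm_sq[OF I J] t_def z_def)
  have uv: "cmod (poly p z) = u" "cmod (poly p (cnj z)) = v" using u v by (auto simp: z_def)
  have d: "\<bar>X \<bullet> w\<bar> > 0" "t\<^sup>2 + \<bar>X \<bullet> w\<bar>\<^sup>2 \<le> 1" using X le by (auto simp: t_def)
  have "\<bar>ln (norm (qeval (qstarpow ?a n) X)) - ln (max (u ^ n) (v ^ n))\<bar> \<le> - ln (\<bar>X \<bullet> w\<bar> / 2)"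
    unfolding qstarpow_slice[OF I]
  proof (rule abs_ln_weighted_le[OF _ _ _ _ _ d])
    show "(norm (qeval (\<lambda>l. slice_emb I (coeff (p ^ n) l)) X))\<^sup>2 =
        (1 + t) / 2 * (u ^ n)\<^sup>2 + (1 - t) / 2 * (v ^ n)\<^sup>2"
      by (simp only: N poly_power norm_power uv)
  qed (use u(2) v(2) in \<open>auto simp: less_max_iff_disj\<close>)
  moreover have "max (u ^ n) (v ^ n) = max u v ^ n"
    using u(2) v(2) power_mono[of u v n] power_mono[of v u n] by (auto simp: max_def)
  ultimately show "\<bar>ln (norm (qeval (qstarpow ?a n) X)) - real n * ln (max u v)\<bar> \<le> - ln (\<bar>X \<bullet> w\<bar> / 2)"
    using u(2) v(2) by (simp add: ln_realpow less_max_iff_disj)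
  \<comment> \<open>The values of P^s at z and at its conjugate both have modulus u v, so the
    weights add up to 1.\<close>
  have sym: "norm (qeval (qsym ?a) X) = u * v"
  proof -
    have "(norm (qeval (qsym ?a) X))\<^sup>2 = (1 + t) / 2 * (u * v)\<^sup>2 + (1 - t) / 2 * (v * u)\<^sup>2"
      unfolding qsym_def qpcnj_slice[OF I] qstar_slice[OF I]
      by (simp only: N poly_mult poly_map_poly_cnj[OF I] norm_mult complex_mod_cnj complex_cnj_cnj uv)
    also have "\<dots> = ((1 + t) / 2 + (1 - t) / 2) * (u * v)\<^sup>2"
      by (simp only: mult.commute[of v u] distrib_right)
    also have "(1 + t) / 2 + (1 - t) / 2 = 1" by (simp add: field_simps)
    finally show ?thesis using u(2) v(2) by (simp add: power2_eq_iff_nonneg)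
  qed
  have "\<bar>ln (norm (qnegstarpow_eval ?a n X)) - ln (max (inverse u ^ n) (inverse v ^ n))\<bar> \<le> - ln (\<bar>X \<bullet> w\<bar> / 2)"
  proof (rule abs_ln_weighted_le[OF _ _ _ _ _ d])
    \<comment> \<open>Conjugating coefficients exchanges the moduli at z and its conjugate. Division
      by (u v)^n turns v^n into u^(-n) and u^n into v^(-n), so each weight is again attached to its
      original value.\<close>
    have "(norm (qeval (qstarpow (qpcnj ?a) n) X))\<^sup>2 = (1 + t) / 2 * (v ^ n)\<^sup>2 + (1 - t) / 2 * (u ^ n)\<^sup>2"
      unfolding qpcnj_slice[OF I] qstarpow_slice[OF I]
      by (simp only: N poly_power poly_map_poly_cnj[OF I] norm_power complex_mod_cnj complex_cnj_cnj uv)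
    moreover have "x * B\<^sup>2 / (A * B)\<^sup>2 = x * (inverse A)\<^sup>2" if "B > 0" for x A B :: real
      using that by (simp add: power_mult_distrib power_inverse divide_inverse)
    from this[of "v ^ n" _ "u ^ n"] this[of "u ^ n" _ "v ^ n"]
    have "x * (v ^ n)\<^sup>2 / ((u * v) ^ n)\<^sup>2 = x * (inverse u ^ n)\<^sup>2"
      "x * (u ^ n)\<^sup>2 / ((u * v) ^ n)\<^sup>2 = x * (inverse v ^ n)\<^sup>2" for x
      using u(2) v(2) by (simp_all only: zero_less_power power_inverse power_mult_distrib mult.commute)
    ultimately show "(norm (qnegstarpow_eval ?a n X))\<^sup>2 =
        (1 + t) / 2 * (inverse u ^ n)\<^sup>2 + (1 - t) / 2 * (inverse v ^ n)\<^sup>2"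
      unfolding norm_qnegstarpow_eval sym power_divide by (simp only: add_divide_distrib)
  qed (use u(2) v(2) in \<open>auto simp: less_max_iff_disj\<close>)
  moreover have "max (inverse u ^ n) (inverse v ^ n) = inverse (min u v) ^ n"
    using u(2) v(2) power_mono[of "inverse u" "inverse v" n] power_mono[of "inverse v" "inverse u" n]
    by (auto simp: max_def min_def)
  ultimately show "\<bar>ln (norm (qnegstarpow_eval ?a n X)) - real n * (- ln (min u v))\<bar> \<le> - ln (\<bar>X \<bullet> w\<bar> / 2)"
    using u(2) v(2) by (simp add: ln_realpow ln_inverse)
qed

lemma mH_limits:
  fixes p :: "complex poly"
  assumes p: "p \<noteq> 0"
  defines "a \<equiv> \<lambda>l. slice_emb I (coeff p l)"
  shows "(\<lambda>n. mH (qeval (qstarpow a n)) / real n) \<longlonglongrightarrow>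
           2 / pi * integral {0..pi} (\<lambda>\<theta>. ln (max (cmod (poly p (cis \<theta>))) (cmod (poly p (cis (- \<theta>))))) * (sin \<theta>)\<^sup>2)"
    and "(\<lambda>m. mH (qnegstarpow_eval a m) / (- real m)) \<longlonglongrightarrow>
           2 / pi * integral {0..pi} (\<lambda>\<theta>. ln (min (cmod (poly p (cis \<theta>))) (cmod (poly p (cis (- \<theta>))))) * (sin \<theta>)\<^sup>2)"
proof -
  define u where "u c = cmod (poly p (upper_pt c))" for c
  define v where "v c = cmod (poly p (cnj (upper_pt c)))" for c
  have [measurable]: "u \<in> borel_measurable borel" "v \<in> borel_measurable borel"
    unfolding u_def[abs_def] v_def[abs_def]
    by (intro borel_measurable_continuous_onI continuous_intros continuous_on_upper_pt)+
  have uv: "u (cos \<theta>) = cmod (poly p (cis \<theta>))" "v (cos \<theta>) = cmod (poly p (cis (- \<theta>)))"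
    if "\<theta> \<in> {0..pi}" for \<theta>
    using upper_pt_cos[OF that] by (simp_all add: u_def v_def cis_cnj)
  have U: "(\<lambda>c. ln (u c)) absolutely_integrable_on {-1..1}"
    unfolding u_def by (rule ln_poly_absolutely_integrable[OF continuous_on_upper_pt _ p]) simp
  have V: "(\<lambda>c. ln (v c)) absolutely_integrable_on {-1..1}"
    unfolding v_def
    by (rule ln_poly_absolutely_integrable[OF _ _ p]) (auto intro!: continuous_intros continuous_on_upper_pt)
  have UV: "(\<lambda>c. \<bar>ln (u c)\<bar> + \<bar>ln (v c)\<bar>) integrable_on {-1..1}"
    using set_integrable_abs[OF U] set_integrable_abs[OF V]
    by (intro integrable_add set_lebesgue_integral_eq_integral(1))
  \<comment> \<open>Max and min each select one of u and v, so this one domination criterion covers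
    both integrands.\<close>
  have dom: "(\<lambda>\<theta>. h (cos \<theta>) * (sin \<theta>)\<^sup>2) absolutely_integrable_on {0..pi}"
    if [measurable]: "h \<in> borel_measurable borel" and le: "\<And>c. \<bar>h c\<bar> \<le> \<bar>ln (u c)\<bar> + \<bar>ln (v c)\<bar>" for h
  proof (rule absolutely_integrable_cos_sin_squared)
    have "h \<in> borel_measurable (lebesgue_on {-1..1})"
      by (intro measurable_restrict_space1 measurable_completion) simp
    then show "h absolutely_integrable_on {-1..1}"
      using UV le by (intro measurable_bounded_by_integrable_imp_absolutely_integrable[where g="\<lambda>c. \<bar>ln (u c)\<bar> + \<bar>ln (v c)\<bar>"]) auto
  qed fact
  obtain w where w: "norm w = 1" "w $ 1 = 0" "w \<bullet> I = 0"
    by (rule exists_imag_unit_orthogonal)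
  define Z where "Z = {c. u c = 0 \<or> v c = 0}"
  have "Z \<subseteq> Re ` {z. poly p z = 0}"
  proof
    fix c assume "c \<in> Z"
    then have "poly p (upper_pt c) = 0 \<or> poly p (cnj (upper_pt c)) = 0"
      by (auto simp: Z_def u_def v_def)
    then show "c \<in> Re ` {z. poly p z = 0}"
      by (metis (mono_tags, lifting) Re_upper_pt complex_cnj(1) complex_cnj_cnj cnj.simps(1) image_eqI mem_Collect_eq)
  qed
  then have "finite Z"
    using poly_roots_finite[OF p] by (metis finite_imageI finite_subset)
  have gen: "AE x in lborel. x \<in> ball 0 1 \<longrightarrow> x \<bullet> w \<noteq> 0 \<and> 0 < u (x $ 1 / norm x) \<and> 0 < v (x $ 1 / norm x)"
  proof -
    have "w \<noteq> 0" using w(1) by auto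
    then have "{x. w \<bullet> x = 0} \<in> null_sets lborel"
      using negligible_hyperplane[of w 0] \<open>w \<noteq> 0\<close>
      by (auto simp: negligible_iff_null_sets null_sets_completion_iff closed_hyperplane)
    then have "AE x in lborel. x \<notin> {x. w \<bullet> x = 0}" by (rule AE_not_in)
    with AE_quat_ball_cone[OF \<open>finite Z\<close>] show ?thesis
      by eventually_elim (auto simp: Z_def u_def v_def inner_commute)
  qed
  \<comment> \<open>Normalising x to X enlarges |x \<bullet> w| because |x| < 1, so a bound at X
    implies the weaker one at x, which depends on a linear coordinate of x alone.\<close>
  have AEb: "AE x in lborel. x \<in> ball 0 1 \<longrightarrow> \<bar>ln (norm (F (x /\<^sub>R norm x))) - k * h (x $ 1 / norm x)\<bar> \<le> - ln (\<bar>x \<bullet> w\<bar> / 2)"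
    if b: "\<And>X. norm X = 1 \<Longrightarrow> X \<bullet> w \<noteq> 0 \<Longrightarrow> 0 < u (X $ 1) \<Longrightarrow> 0 < v (X $ 1) \<Longrightarrow>
      \<bar>ln (norm (F X)) - k * h (X $ 1)\<bar> \<le> - ln (\<bar>X \<bullet> w\<bar> / 2)" for F :: "quat \<Rightarrow> quat" and k h
    using gen
  proof (eventually_elim, intro impI)
    fix x :: quat
    assume g: "x \<in> ball 0 1 \<longrightarrow> x \<bullet> w \<noteq> 0 \<and> 0 < u (x $ 1 / norm x) \<and> 0 < v (x $ 1 / norm x)"
      and x: "x \<in> ball 0 1"
    then have x0: "x \<bullet> w \<noteq> 0" "x \<noteq> 0" by auto
    define X where "X = x /\<^sub>R norm x"
    have X: "norm X = 1" "X $ 1 = x $ 1 / norm x" "X \<bullet> w = x \<bullet> w / norm x"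
      using x0 by (simp_all add: X_def divide_inverse mult.commute)
    have "\<bar>x \<bullet> w\<bar> * norm x \<le> \<bar>x \<bullet> w\<bar> * 1"
      using x by (intro mult_left_mono) auto
    then have "\<bar>x \<bullet> w\<bar> \<le> \<bar>X \<bullet> w\<bar>"
      using x0 by (simp add: X field_simps)
    then have "- ln (\<bar>X \<bullet> w\<bar> / 2) \<le> - ln (\<bar>x \<bullet> w\<bar> / 2)"
      using x0 by simp
    moreover have "\<bar>ln (norm (F X)) - k * h (X $ 1)\<bar> \<le> - ln (\<bar>X \<bullet> w\<bar> / 2)"
      using g x x0 X by (intro b) auto
    ultimately show "\<bar>ln (norm (F (x /\<^sub>R norm x))) - k * h (x $ 1 / norm x)\<bar> \<le> - ln (\<bar>x \<bullet> w\<bar> / 2)"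
      unfolding X(2) X_def[symmetric] by linarith
  qed
  have "(\<lambda>n. mH (qeval (qstarpow a n)) / real n) \<longlonglongrightarrow>
      2 / pi * integral {0..pi} (\<lambda>\<theta>. ln (max (u (cos \<theta>)) (v (cos \<theta>))) * (sin \<theta>)\<^sup>2)"
  proof (rule mH_div_tendsto[OF w(1), where h="\<lambda>c. ln (max (u c) (v c))"])
    show "(\<lambda>\<theta>. ln (max (u (cos \<theta>)) (v (cos \<theta>))) * (sin \<theta>)\<^sup>2) absolutely_integrable_on {0..pi}"
      by (rule dom[where h="\<lambda>c. ln (max (u c) (v c))"]) (measurable)
    show "AE x in lborel. x \<in> ball 0 1 \<longrightarrow> \<bar>ln (norm (qeval (qstarpow a n) (x /\<^sub>R norm x))) -
        real n * ln (max (u (x $ 1 / norm x)) (v (x $ 1 / norm x)))\<bar> \<le> - ln (\<bar>x \<bullet> w\<bar> / 2)" for n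
      unfolding a_def
      by (rule AEb[where h="\<lambda>c. ln (max (u c) (v c))"], rule qeval_on_sphere_bounds[OF w])
         (simp_all add: u_def v_def)
  qed measurable
  also have "integral {0..pi} (\<lambda>\<theta>. ln (max (u (cos \<theta>)) (v (cos \<theta>))) * (sin \<theta>)\<^sup>2) =
      integral {0..pi} (\<lambda>\<theta>. ln (max (cmod (poly p (cis \<theta>))) (cmod (poly p (cis (- \<theta>))))) * (sin \<theta>)\<^sup>2)"
    by (intro integral_cong) (simp add: uv)
  finally show "(\<lambda>n. mH (qeval (qstarpow a n)) / real n) \<longlonglongrightarrow>
      2 / pi * integral {0..pi} (\<lambda>\<theta>. ln (max (cmod (poly p (cis \<theta>))) (cmod (poly p (cis (- \<theta>))))) * (sin \<theta>)\<^sup>2)" .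
  have [measurable]: "(\<lambda>x. norm (qnegstarpow_eval a n x)) \<in> borel_measurable borel" for n
    unfolding norm_qnegstarpow_eval by measurable
  have "(\<lambda>n. mH (qnegstarpow_eval a n) / real n) \<longlonglongrightarrow>
      2 / pi * integral {0..pi} (\<lambda>\<theta>. - ln (min (u (cos \<theta>)) (v (cos \<theta>))) * (sin \<theta>)\<^sup>2)"
  proof (rule mH_div_tendsto[OF w(1), where h="\<lambda>c. - ln (min (u c) (v c))"])
    show "(\<lambda>\<theta>. - ln (min (u (cos \<theta>)) (v (cos \<theta>))) * (sin \<theta>)\<^sup>2) absolutely_integrable_on {0..pi}"
      by (rule dom[where h="\<lambda>c. - ln (min (u c) (v c))"]) (measurable)
    show "AE x in lborel. x \<in> ball 0 1 \<longrightarrow> \<bar>ln (norm (qnegstarpow_eval a n (x /\<^sub>R norm x))) -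
        real n * (- ln (min (u (x $ 1 / norm x)) (v (x $ 1 / norm x))))\<bar> \<le> - ln (\<bar>x \<bullet> w\<bar> / 2)" for n
      unfolding a_def
      by (rule AEb[where h="\<lambda>c. - ln (min (u c) (v c))"], rule qeval_on_sphere_bounds[OF w])
         (simp_all add: u_def v_def)
  qed measurable
  from tendsto_minus[OF this]
  have "(\<lambda>m. mH (qnegstarpow_eval a m) / (- real m)) \<longlonglongrightarrow>
      2 / pi * integral {0..pi} (\<lambda>\<theta>. ln (min (u (cos \<theta>)) (v (cos \<theta>))) * (sin \<theta>)\<^sup>2)"
    by simp
  also have "integral {0..pi} (\<lambda>\<theta>. ln (min (u (cos \<theta>)) (v (cos \<theta>))) * (sin \<theta>)\<^sup>2) =
      integral {0..pi} (\<lambda>\<theta>. ln (min (cmod (poly p (cis \<theta>))) (cmod (poly p (cis (- \<theta>))))) * (sin \<theta>)\<^sup>2)"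
    by (intro integral_cong) (simp add: uv)
  finally show "(\<lambda>m. mH (qnegstarpow_eval a m) / (- real m)) \<longlonglongrightarrow>
      2 / pi * integral {0..pi} (\<lambda>\<theta>. ln (min (cmod (poly p (cis \<theta>))) (cmod (poly p (cis (- \<theta>))))) * (sin \<theta>)\<^sup>2)" .
qed

end

theorem theorem5p4:
  fixes I :: quat and a :: "nat \<Rightarrow> quat"
  assumes "I \<in> unit_imag"
    and "finite {l. a l \<noteq> 0}"
    and "\<exists>l. a l \<noteq> 0"
    and "\<forall>l. a l \<in> slice I"
  shows "(\<lambda>n. mH (qeval (qstarpow a n)) / real n) \<longlonglongrightarrow>
           (2 / pi) * integral {0..pi} (\<lambda>\<theta>.
              ln (max (norm (qeval a (qexpI I \<theta>))) (norm (qeval a (qexpI I (- \<theta>)))))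
              * (sin \<theta>)^2)
    \<and>
         (\<lambda>m. mH (qnegstarpow_eval a m) / (- real m)) \<longlonglongrightarrow>
           (2 / pi) * integral {0..pi} (\<lambda>\<theta>.
              ln (min (norm (qeval a (qexpI I \<theta>))) (norm (qeval a (qexpI I (- \<theta>)))))
              * (sin \<theta>)^2)"
proof -
  obtain p where a: "a = (\<lambda>l. slice_emb I (coeff p l))"
    using slice_poly_obtain[OF assms(1,2,4)] by blast
  then have "p \<noteq> 0" using assms(3) by auto
  \<comment> \<open>\<open>qexpI I \<theta>\<close> is the image of \<open>cis \<theta>\<close>, so
    the integrands become moduli of the complex polynomial \<open>p\<close>.\<close>
  then show ?thesis
    unfolding a slice_emb_cis[symmetric] norm_qeval_slice[OF assms(1)]
    using mH_limits[OF assms(1) \<open>p \<noteq> 0\<close>] by blast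
qed

end
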